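(* Let $\phi=(\phi_t)_{t\in\mathbb{R}}$ be a flow generated by a $C^1$ vector field $X$ on a compact manifold $M$ and let $\mu$ be a Borel probability measure on $M$. Then the following statements are equivalent: (1) $\mu$ is rescaled expansive for $\phi$; (2) for every $\alpha\in(0,1)$ there exists $\varepsilon>0$ such that $\mu(\Gamma^{\alpha}_{\varepsilon}(x))=0$ for $\mu$-almost every $x\in M$; (3) for every $\alpha\in(0,1)$ there exists $\varepsilon>0$ such that $\mu(\Gamma^{\alpha,\ast}_{\varepsilon}(x))=0$ for $\mu$-almost every $x\in M$.
   Context: $M$ is a compact Riemannian manifold with distance $d$ and norm $\|\cdot\|$ on tangent spaces; $X$ may have singularities (zeros). $C^0_0$ is the set of continuous functions $h:\mathbb{R}\to\mathbb{R}$ with $h(0)=0$. $Rep=\{h\in C^0_0: h \text{ is an increasing homeomorphism of } \mathbb{R}\}$. For $\alpha\in(0,1)$, $Rep(\alpha)=\{h\in C^0_0: |\frac{h(s)-h(t)}{s-t}-1|\le\alpha \text{ for all } s\ne t\}$. For $x\in M$, $\varepsilon>0$ define $\Gamma_\varepsilon(x)=\{y\in M:\exists h\in C^0_0 \text{ such that } d(\phi_s(x),\phi_{h(s)}(y))\le\varepsilon\|X(\phi_s(x))\|\ \forall s\in\mathbb{R}\}$; the set $\Gamma^{\alpha}_\varepsilon(x)$ is defined in the same way with $h\in Rep(\alpha)$ in place of $h\in C^0_0$, and $\Gamma^{\alpha,\ast}_\varepsilon(x)$ in the same way with $h\in Rep(\alpha)\cap Rep$. A Borel probability measure $\mu$ on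 $M$ (not necessarily invariant) is called rescaled expansive for $\phi$ if there exists $\varepsilon>0$ such that $\mu(\Gamma_\varepsilon(x))=0$ for every $x\in M$. *)

theory Defs
  imports "HOL-Probability.Probability"
begin

section \<open>Smooth maps between Euclidean spaces\<close>

text \<open>Maps of class $C^k$; meaningful for open sets only.  A map is of class $C^{k+1}$ if it is
  differentiable and all its directional derivatives are of class $C^k$.\<close>

primrec Ck_on :: "nat \<Rightarrow> 'a::euclidean_space set \<Rightarrow> ('a \<Rightarrow> 'b::real_normed_vector) \<Rightarrow> bool" where
  "Ck_on 0 S f \<longleftrightarrow> continuous_on S f"
| "Ck_on (Suc k) S f \<longleftrightarrow>
     (\<exists>f'. (\<forall>x\<in>S. (f has_derivative f' x) (at x)) \<and> (\<forall>v. Ck_on k S (\<lambda>x. f' x v)))"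

definition smooth_on :: "'a::euclidean_space set \<Rightarrow> ('a \<Rightarrow> 'b::real_normed_vector) \<Rightarrow> bool" where
  "smooth_on S f \<longleftrightarrow> (\<forall>k. Ck_on k S f)"


section \<open>Smooth manifolds (without boundary)\<close>

text \<open>The manifold is a whole Hausdorff type \<open>'m\<close>, modelled on the Euclidean space \<open>'e\<close>.
  The value of a chart map outside the chart domain is irrelevant.\<close>

type_synonym ('m, 'e) chart = "'m set \<times> ('m \<Rightarrow> 'e)"

abbreviation chart_dom :: "('m, 'e) chart \<Rightarrow> 'm set" where
  "chart_dom c \<equiv> fst c"

abbreviation chart_map :: "('m, 'e) chart \<Rightarrow> 'm \<Rightarrow> 'e" where
  "chart_map c \<equiv> snd c"

abbreviation chart_inv :: "('m, 'e) chart \<Rightarrow> 'e \<Rightarrow> 'm" where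
  "chart_inv c \<equiv> inv_into (chart_dom c) (chart_map c)"

abbreviation chart_image :: "('m, 'e) chart \<Rightarrow> 'e set" where
  "chart_image c \<equiv> chart_map c ` chart_dom c"

definition is_chart :: "('m::t2_space, 'e::euclidean_space) chart \<Rightarrow> bool" where
  "is_chart c \<longleftrightarrow> open (chart_dom c) \<and> open (chart_image c) \<and>
     homeomorphism (chart_dom c) (chart_image c) (chart_map c) (chart_inv c)"

definition transition :: "('m, 'e) chart \<Rightarrow> ('m, 'e) chart \<Rightarrow> 'e \<Rightarrow> 'e" where
  "transition c c' = chart_map c' \<circ> chart_inv c"

definition smooth_atlas :: "('m::t2_space, 'e::euclidean_space) chart set \<Rightarrow> bool" where
  "smooth_atlas A \<longleftrightarrow>
     (\<forall>c\<in>A. is_chart c) \<and> (\<Union>c\<in>A. chart_dom c) = UNIV \<and>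
     (\<forall>c\<in>A. \<forall>c'\<in>A. smooth_on (chart_map c ` (chart_dom c \<inter> chart_dom c')) (transition c c'))"


section \<open>Tangent vectors\<close>

text \<open>A tangent vector at \<open>p\<close> is the family of its coordinate vectors, one for every chart of the
  atlas around \<open>p\<close>, related by the derivatives of the transition maps.  The components at all
  other indices are set to \<open>0\<close>, so that tangent vectors are equal iff their coordinates are.
  The linear structure is componentwise.\<close>

type_synonym ('m, 'e) tvec = "('m, 'e) chart \<Rightarrow> 'e"

definition tangent_space ::
    "('m::t2_space, 'e::euclidean_space) chart set \<Rightarrow> 'm \<Rightarrow> ('m, 'e) tvec set" where
  "tangent_space A p = {v.
     (\<forall>c\<in>A. \<forall>c'\<in>A. p \<in> chart_dom c \<longrightarrow> p \<in> chart_dom c' \<longrightarrow>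
        v c' = frechet_derivative (transition c c') (at (chart_map c p)) (v c)) \<and>
     (\<forall>c. \<not> (c \<in> A \<and> p \<in> chart_dom c) \<longrightarrow> v c = 0)}"

text \<open>The tangent vector at \<open>p\<close> with coordinates \<open>u\<close> in the chart \<open>c\<close>.\<close>

definition coord_vec ::
    "('m::t2_space, 'e::euclidean_space) chart set \<Rightarrow> ('m, 'e) chart \<Rightarrow> 'm \<Rightarrow> 'e \<Rightarrow> ('m, 'e) tvec" where
  "coord_vec A c p u = (\<lambda>c'. if c' \<in> A \<and> p \<in> chart_dom c'
     then frechet_derivative (transition c c') (at (chart_map c p)) u else 0)"

definition C1_vector_field ::
    "('m::t2_space, 'e::euclidean_space) chart set \<Rightarrow> ('m \<Rightarrow> ('m, 'e) tvec) \<Rightarrow> bool" where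
  "C1_vector_field A X \<longleftrightarrow>
     (\<forall>p. X p \<in> tangent_space A p) \<and>
     (\<forall>c\<in>A. Ck_on 1 (chart_image c) (\<lambda>z. X (chart_inv c z) c))"


section \<open>Riemannian metrics and the Riemannian distance\<close>

text \<open>The last clause says that the coefficients of the metric in every chart are smooth.\<close>

definition riemannian_metric :: "('m::t2_space, 'e::euclidean_space) chart set \<Rightarrow>
    ('m \<Rightarrow> ('m, 'e) tvec \<Rightarrow> ('m, 'e) tvec \<Rightarrow> real) \<Rightarrow> bool" where
  "riemannian_metric A g \<longleftrightarrow>
     (\<forall>p. \<forall>u\<in>tangent_space A p. \<forall>v\<in>tangent_space A p.
        g p u v = g p v u \<and>
        (\<forall>w\<in>tangent_space A p. \<forall>a b.
           g p (\<lambda>c. a *\<^sub>R u c + b *\<^sub>R v c) w = a * g p u w + b * g p v w)) \<and>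
     (\<forall>p. \<forall>u\<in>tangent_space A p. u \<noteq> (\<lambda>c. 0) \<longrightarrow> g p u u > 0) \<and>
     (\<forall>c\<in>A. \<forall>u v. smooth_on (chart_image c)
        (\<lambda>z. g (chart_inv c z) (coord_vec A c (chart_inv c z) u) (coord_vec A c (chart_inv c z) v)))"

definition tnorm :: "('m \<Rightarrow> ('m, 'e) tvec \<Rightarrow> ('m, 'e) tvec \<Rightarrow> real) \<Rightarrow> 'm \<Rightarrow> ('m, 'e) tvec \<Rightarrow> real" where
  "tnorm g p v = sqrt (g p v v)"

text \<open>\<open>\<gamma>\<close> is a $C^1$ curve on the closed interval $[a,b]$ with velocity \<open>V\<close> (one-sided at the
  end points).\<close>

definition C1_curve_on :: "('m::t2_space, 'e::euclidean_space) chart set \<Rightarrow>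
    real \<Rightarrow> real \<Rightarrow> (real \<Rightarrow> 'm) \<Rightarrow> (real \<Rightarrow> ('m, 'e) tvec) \<Rightarrow> bool" where
  "C1_curve_on A a b \<gamma> V \<longleftrightarrow>
     continuous_on {a..b} \<gamma> \<and>
     (\<forall>t\<in>{a..b}. V t \<in> tangent_space A (\<gamma> t)) \<and>
     (\<forall>c\<in>A.
        (\<forall>t\<in>{a..b}. \<gamma> t \<in> chart_dom c \<longrightarrow>
           ((\<lambda>s. chart_map c (\<gamma> s)) has_vector_derivative V t c) (at t within {a..b})) \<and>
        continuous_on {t\<in>{a..b}. \<gamma> t \<in> chart_dom c} (\<lambda>t. V t c))"

text \<open>\<open>\<gamma>\<close> is a piecewise $C^1$ curve on $[0,1]$ of length \<open>L\<close>; the numbers \<open>\<tau> i\<close> are the break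
  points.\<close>

definition curve_has_length :: "('m::t2_space, 'e::euclidean_space) chart set \<Rightarrow>
    ('m \<Rightarrow> ('m, 'e) tvec \<Rightarrow> ('m, 'e) tvec \<Rightarrow> real) \<Rightarrow> (real \<Rightarrow> 'm) \<Rightarrow> real \<Rightarrow> bool" where
  "curve_has_length A g \<gamma> L \<longleftrightarrow>
     (\<exists>(n::nat) (\<tau> :: nat \<Rightarrow> real) V.
        \<tau> 0 = 0 \<and> \<tau> n = 1 \<and>
        (\<forall>i<n. \<tau> i < \<tau> (Suc i) \<and> C1_curve_on A (\<tau> i) (\<tau> (Suc i)) \<gamma> (V i)) \<and>
        L = (\<Sum>i<n. integral {\<tau> i..\<tau> (Suc i)} (\<lambda>t. tnorm g (\<gamma> t) (V i t))))"

text \<open>The manifold is not assumed to be connected: the distance between points of different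
  components is the infimum of the empty set, \<open>\<infinity>\<close>.\<close>

definition rdist :: "('m::t2_space, 'e::euclidean_space) chart set \<Rightarrow>
    ('m \<Rightarrow> ('m, 'e) tvec \<Rightarrow> ('m, 'e) tvec \<Rightarrow> real) \<Rightarrow> 'm \<Rightarrow> 'm \<Rightarrow> ennreal" where
  "rdist A g x y =
     Inf {ennreal L |L. \<exists>\<gamma>. \<gamma> 0 = x \<and> \<gamma> 1 = y \<and> curve_has_length A g \<gamma> L}"


section \<open>Flows\<close>

definition is_flow :: "(real \<Rightarrow> 'm::topological_space \<Rightarrow> 'm) \<Rightarrow> bool" where
  "is_flow \<phi> \<longleftrightarrow>
     continuous_on UNIV (\<lambda>(t, x). \<phi> t x) \<and>
     (\<forall>x. \<phi> 0 x = x) \<and> (\<forall>s t x. \<phi> (s + t) x = \<phi> s (\<phi> t x))"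

definition flow_generated_by :: "('m::t2_space, 'e::euclidean_space) chart set \<Rightarrow>
    ('m \<Rightarrow> ('m, 'e) tvec) \<Rightarrow> (real \<Rightarrow> 'm \<Rightarrow> 'm) \<Rightarrow> bool" where
  "flow_generated_by A X \<phi> \<longleftrightarrow>
     is_flow \<phi> \<and>
     (\<forall>x t. \<forall>c\<in>A. \<phi> t x \<in> chart_dom c \<longrightarrow>
        ((\<lambda>s. chart_map c (\<phi> s x)) has_vector_derivative X (\<phi> t x) c) (at t))"


section \<open>Reparametrizations and rescaled expansive measures\<close>

definition C00 :: "(real \<Rightarrow> real) set" where
  "C00 = {h. continuous_on UNIV h \<and> h 0 = 0}"

definition Rep :: "(real \<Rightarrow> real) set" where
  "Rep = {h \<in> C00. strict_mono h \<and> (\<exists>h'. homeomorphism UNIV UNIV h h')}"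

definition Rep_alpha :: "real \<Rightarrow> (real \<Rightarrow> real) set" where
  "Rep_alpha \<alpha> = {h \<in> C00. \<forall>s t. s \<noteq> t \<longrightarrow> \<bar>(h s - h t) / (s - t) - 1\<bar> \<le> \<alpha>}"

text \<open>The common form of the three sets $\Gamma$, with reparametrizations taken from \<open>H\<close>.\<close>

definition Gamma_with :: "('m::t2_space, 'e::euclidean_space) chart set \<Rightarrow>
    ('m \<Rightarrow> ('m, 'e) tvec \<Rightarrow> ('m, 'e) tvec \<Rightarrow> real) \<Rightarrow> ('m \<Rightarrow> ('m, 'e) tvec) \<Rightarrow>
    (real \<Rightarrow> 'm \<Rightarrow> 'm) \<Rightarrow> (real \<Rightarrow> real) set \<Rightarrow> real \<Rightarrow> 'm \<Rightarrow> 'm set" where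
  "Gamma_with A g X \<phi> H \<epsilon> x =
     {y. \<exists>h\<in>H. \<forall>s. rdist A g (\<phi> s x) (\<phi> (h s) y)
                     \<le> ennreal (\<epsilon> * tnorm g (\<phi> s x) (X (\<phi> s x)))}"

definition Gamma where
  "Gamma A g X \<phi> \<epsilon> x = Gamma_with A g X \<phi> C00 \<epsilon> x"

definition Gamma_alpha where
  "Gamma_alpha A g X \<phi> \<alpha> \<epsilon> x = Gamma_with A g X \<phi> (Rep_alpha \<alpha>) \<epsilon> x"

definition Gamma_alpha_star where
  "Gamma_alpha_star A g X \<phi> \<alpha> \<epsilon> x = Gamma_with A g X \<phi> (Rep_alpha \<alpha> \<inter> Rep) \<epsilon> x"

text \<open>The sets $\Gamma$ need not be Borel, and \<open>emeasure\<close> is \<open>0\<close> by convention on non-measurable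
  sets.  So $\mu(S)=0$ is read in the completion of \<open>\<mu>\<close>: \<open>S\<close> is contained in a Borel set of
  measure zero.\<close>

definition measure_zero :: "'m measure \<Rightarrow> 'm set \<Rightarrow> bool" where
  "measure_zero \<mu> S \<longleftrightarrow> S \<in> null_sets (completion \<mu>)"

definition rescaled_expansive :: "('m::t2_space, 'e::euclidean_space) chart set \<Rightarrow>
    ('m \<Rightarrow> ('m, 'e) tvec \<Rightarrow> ('m, 'e) tvec \<Rightarrow> real) \<Rightarrow> ('m \<Rightarrow> ('m, 'e) tvec) \<Rightarrow>
    (real \<Rightarrow> 'm \<Rightarrow> 'm) \<Rightarrow> 'm measure \<Rightarrow> bool" where
  "rescaled_expansive A g X \<phi> \<mu> \<longleftrightarrow> (\<exists>\<epsilon>>0. \<forall>x. measure_zero \<mu> (Gamma A g X \<phi> \<epsilon> x))"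

end

theory Submission
  imports Defs
begin

text \<open>By compactness, around every point there is a chart in which, with uniform constants, the
  Riemannian distance and norm are comparable to the Euclidean ones and \<open>X\<close> is Lipschitz.  If the
  orbits of \<open>x\<close> and \<open>y\<close> stay within \<open>\<delta> \<parallel>X\<parallel>\<close> of each other under a reparametrization \<open>h\<close>, then, as
  \<open>X\<close> is almost constant at this scale, the two points travel at almost the same speed relative to
  \<open>\<parallel>X\<parallel>\<close>; so \<open>h (s + u) - h s\<close> is close to \<open>u\<close> for short times \<open>u\<close>, and a sliding average of \<open>h\<close> lies
  in \<open>Rep_alpha\<close> and is uniformly close to \<open>h\<close>.  Comparing two points \<open>y\<close>, \<open>z\<close> of \<open>\<Gamma>\<^sub>\<delta>(x)\<close> through
  their averaged reparametrizations \<open>h\<close> and \<open>k\<close>, that is, by \<open>k \<circ> h\<^sup>-\<^sup>1\<close>, gives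
  \<open>\<Gamma>\<^sub>\<delta>(x) \<subseteq> \<Gamma>\<^sup>\<alpha>\<^sub>\<epsilon>(y)\<close> for every \<open>y \<in> \<Gamma>\<^sub>\<delta>(x)\<close>.  If \<open>\<Gamma>\<^sub>\<delta>(x)\<close> were not null, \<open>y\<close> could be chosen
  outside the exceptional null set, making the right-hand side null.\<close>

subsection \<open>Short-time estimates and reparametrizations\<close>

text \<open>A Gronwall estimate without exponentials: at a maximum point \<open>m\<close> of the
  norm on the interval, the mean value inequality gives
  \<open>norm (D m) \<le> norm (D 0) + \<tau> * (L * norm (D m) + b)\<close>, and
  \<open>\<tau> * L \<le> 1/2\<close> lets half of \<open>norm (D m)\<close> be absorbed on the
  left.\<close>

lemma short_time_bound:
  fixes D :: "real \<Rightarrow> 'a::real_normed_vector"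
  assumes deriv: "\<And>t. \<bar>t\<bar> \<le> \<tau> \<Longrightarrow> (D has_vector_derivative D' t) (at t)"
    and bound: "\<And>t. \<bar>t\<bar> \<le> \<tau> \<Longrightarrow> norm (D' t) \<le> L * norm (D t) + b"
    and L: "0 \<le> L" "\<tau> * L \<le> 1/2" and t: "\<bar>t\<bar> \<le> \<tau>"
  shows "norm (D t) \<le> 2 * (norm (D 0) + \<tau> * b)"
proof -
  have \<tau>: "0 \<le> \<tau>" using t by linarith
  have cont: "continuous_on {-\<tau>..\<tau>} D"
    by (intro continuous_at_imp_continuous_on ballI)
      (auto intro!: has_vector_derivative_continuous[OF deriv])
  obtain m where m: "m \<in> {-\<tau>..\<tau>}" "\<And>t. t \<in> {-\<tau>..\<tau>} \<Longrightarrow> norm (D t) \<le> norm (D m)"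
    using continuous_attains_sup[OF compact_Icc _ continuous_on_norm[OF cont]] \<tau> by force
  have D': "norm (D' t) \<le> L * norm (D m) + b" if "t \<in> {-\<tau>..\<tau>}" for t
    using bound[of t] m(2)[OF that] L(1) that
    by (smt (verit) abs_le_iff atLeastAtMost_iff mult_left_mono)
  have nn: "0 \<le> L * norm (D m) + b"
    using D'[of m] m(1) norm_ge_zero order_trans by blast
  have "norm (D m - D 0) \<le> (L * norm (D m) + b) * norm (m - 0)"
  proof (rule differentiable_bound[of "{-\<tau>..\<tau>}" D "\<lambda>t x. x *\<^sub>R D' t"])
    show "(D has_derivative (\<lambda>x. x *\<^sub>R D' t)) (at t within {-\<tau>..\<tau>})" if "t \<in> {-\<tau>..\<tau>}" for t
      using deriv[of t] that by (auto simp: has_vector_derivative_def has_derivative_at_withinI)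
    show "onorm (\<lambda>x. x *\<^sub>R D' t) \<le> L * norm (D m) + b" if "t \<in> {-\<tau>..\<tau>}" for t
      using mult_left_mono[OF D'[OF that], of "\<bar>x\<bar>" for x]
      by (intro onorm_bound nn) (simp add: mult.commute)
  qed (use m \<tau> in auto)
  also have "\<dots> \<le> (L * norm (D m) + b) * \<tau>"
    using m(1) nn by (intro mult_left_mono) auto
  also have "\<dots> = (\<tau> * L) * norm (D m) + \<tau> * b" by (simp add: algebra_simps)
  also have "\<dots> \<le> 1/2 * norm (D m) + \<tau> * b"
    using L(2) by (intro add_right_mono mult_right_mono) auto
  finally have "norm (D m) \<le> norm (D 0) + 1/2 * norm (D m) + \<tau> * b"
    using norm_triangle_ineq2[of "D m" "D 0"] by linarith
  moreover have "norm (D t) \<le> norm (D m)" using m(2)[of t] t by (auto simp: abs_le_iff)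
  ultimately show ?thesis by (simp add: algebra_simps)
qed

text \<open>Bootstrapping for a curve \<open>e\<close> whose velocity \<open>v\<close> is controlled
  by the displacement: the crude bound \<open>2 * \<tau> * norm (v 0)\<close> on the displacement
  forces the velocity to vary by at most \<open>norm (v 0) / 2\<close>, which in turn makes
  \<open>e\<close> nearly affine. All errors are relative to \<open>norm (v 0)\<close>, so they
  remain useful near zeros of a vector field.\<close>

lemma short_time_affine:
  fixes e :: "real \<Rightarrow> 'a::real_normed_vector"
  assumes deriv: "\<And>t. \<bar>t\<bar> \<le> \<tau> \<Longrightarrow> (e has_vector_derivative v t) (at t)"
    and lip: "\<And>t. \<bar>t\<bar> \<le> \<tau> \<Longrightarrow> norm (v t - v 0) \<le> L * norm (e t - e 0)"
    and L: "0 \<le> L" "4 * \<tau> * L \<le> 1"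
  shows "\<bar>t\<bar> \<le> \<tau> \<Longrightarrow> norm (v t - v 0) \<le> norm (v 0) / 2"
    and "\<bar>a\<bar> \<le> \<tau> \<Longrightarrow> \<bar>b\<bar> \<le> \<tau> \<Longrightarrow>
      norm (e a - e b - (a - b) *\<^sub>R v 0) \<le> \<bar>a - b\<bar> * norm (v 0) / 2"
proof -
  have e: "norm (e t - e 0) \<le> 2 * \<tau> * norm (v 0)" if t: "\<bar>t\<bar> \<le> \<tau>" for t
  proof -
    have "norm (e t - e 0) \<le> 2 * (norm (e 0 - e 0) + \<tau> * norm (v 0))"
    proof (rule short_time_bound[where D = "\<lambda>t. e t - e 0" and D' = v and L = L])
      show "((\<lambda>t. e t - e 0) has_vector_derivative v t) (at t)" if "\<bar>t\<bar> \<le> \<tau>" for t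
        using deriv[OF that] by (auto intro!: derivative_eq_intros)
      show "norm (v t) \<le> L * norm (e t - e 0) + norm (v 0)" if "\<bar>t\<bar> \<le> \<tau>" for t
        using lip[OF that] norm_triangle_ineq2[of "v t" "v 0"] by linarith
    qed (use L t in auto)
    then show ?thesis by simp
  qed
  show v: "norm (v t - v 0) \<le> norm (v 0) / 2" if t: "\<bar>t\<bar> \<le> \<tau>" for t
  proof -
    have "norm (v t - v 0) \<le> L * (2 * \<tau> * norm (v 0))"
      using lip[OF t] mult_left_mono[OF e[OF t] L(1)] by linarith
    also have "\<dots> = (4 * \<tau> * L) * (norm (v 0) / 2)" by simp
    also have "\<dots> \<le> 1 * (norm (v 0) / 2)"
      using L(2) by (intro mult_right_mono) auto
    finally show ?thesis by simp
  qed
  show "norm (e a - e b - (a - b) *\<^sub>R v 0) \<le> \<bar>a - b\<bar> * norm (v 0) / 2"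
    if ab: "\<bar>a\<bar> \<le> \<tau>" "\<bar>b\<bar> \<le> \<tau>"
  proof -
    have "norm ((e a - a *\<^sub>R v 0) - (e b - b *\<^sub>R v 0)) \<le> (norm (v 0) / 2) * norm (a - b)"
    proof (rule differentiable_bound[of "{-\<tau>..\<tau>}" _ "\<lambda>t x. x *\<^sub>R (v t - v 0)"])
      show "((\<lambda>t. e t - t *\<^sub>R v 0) has_derivative (\<lambda>x. x *\<^sub>R (v t - v 0))) (at t within {-\<tau>..\<tau>})"
        if "t \<in> {-\<tau>..\<tau>}" for t
      proof -
        have "((\<lambda>t. e t - t *\<^sub>R v 0) has_vector_derivative (v t - v 0)) (at t)"
          using deriv[of t] that by (auto intro!: derivative_eq_intros)
        then show ?thesis by (auto simp: has_vector_derivative_def has_derivative_at_withinI)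
      qed
      show "onorm (\<lambda>x. x *\<^sub>R (v t - v 0)) \<le> norm (v 0) / 2" if "t \<in> {-\<tau>..\<tau>}" for t
        using mult_left_mono[OF v[of t], of "\<bar>x\<bar>" for x] that
        by (intro onorm_bound) (auto simp: mult.commute)
    qed (use ab in auto)
    then show ?thesis by (simp add: algebra_simps)
  qed
qed

section \<open>Reparametrizations with slopes close to 1\<close>

lemma Rep_alpha_bound:
  assumes "h \<in> Rep_alpha \<alpha>"
  shows "\<bar>h s - h t - (s - t)\<bar> \<le> \<alpha> * \<bar>s - t\<bar>"
proof (cases "s = t")
  case False
  then have "\<bar>(h s - h t) / (s - t) - 1\<bar> \<le> \<alpha>" using assms by (auto simp: Rep_alpha_def)
  moreover have "h s - h t - (s - t) = ((h s - h t) / (s - t) - 1) * (s - t)"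
    using False by (simp add: field_simps)
  ultimately show ?thesis by (simp add: abs_mult mult_right_mono)
qed simp

text \<open>The bound itself makes \<open>h\<close> Lipschitz, so membership in \<open>C00\<close>
  costs only \<open>h 0 = 0\<close>.\<close>

lemma Rep_alphaI:
  assumes "h 0 = 0" and b: "\<And>s t. \<bar>h s - h t - (s - t)\<bar> \<le> \<alpha> * \<bar>s - t\<bar>"
  shows "h \<in> Rep_alpha \<alpha>"
proof -
  have "(1 + \<bar>\<alpha>\<bar>)-lipschitz_on UNIV h"
  proof (rule lipschitz_onI)
    show "dist (h x) (h y) \<le> (1 + \<bar>\<alpha>\<bar>) * dist x y" for x y
    proof -
      have "\<alpha> * \<bar>x - y\<bar> \<le> \<bar>\<alpha>\<bar> * \<bar>x - y\<bar>" by (intro mult_right_mono) auto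
      then show ?thesis using b[of x y] unfolding dist_real_def by (simp add: algebra_simps)
    qed
  qed simp
  then have "continuous_on UNIV h" by (rule lipschitz_on_continuous_on)
  moreover have "\<bar>(h s - h t) / (s - t) - 1\<bar> \<le> \<alpha>" if "s \<noteq> t" for s t
  proof -
    have "(h s - h t) / (s - t) - 1 = (h s - h t - (s - t)) / (s - t)"
      using that by (simp add: field_simps)
    then show ?thesis using b[of s t] that by (simp add: divide_le_eq)
  qed
  ultimately show ?thesis using assms(1) by (simp add: Rep_alpha_def C00_def)
qed

lemma Rep_alpha_expands:
  assumes "h \<in> Rep_alpha \<alpha>" 
  shows "(1 - \<alpha>) * \<bar>s - t\<bar> \<le> \<bar>h s - h t\<bar>"
  using Rep_alpha_bound[OF assms, of s t] by (simp add: algebra_simps)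

lemma Rep_alpha_strict_mono:
  assumes "h \<in> Rep_alpha \<alpha>" "\<alpha> < 1"
  shows "strict_mono h"
proof (rule strict_monoI)
  fix s t :: real assume "s < t"
  then have "\<alpha> * \<bar>t - s\<bar> < t - s" using assms(2) by simp
  then show "h s < h t" using Rep_alpha_bound[OF assms(1), of t s] by linarith
qed

lemma Rep_alpha_surj:
  assumes h: "h \<in> Rep_alpha \<alpha>" and \<alpha>: "\<alpha> < 1"
  shows "surj h"
proof -
  have h0: "h 0 = 0" and cont: "continuous_on UNIV h" using h by (auto simp: Rep_alpha_def C00_def)
  have "\<exists>x. h x = y" for y
  proof -
    \<comment> \<open>With slopes at least \<open>1 - \<alpha>\<close>, \<open>h\<close> has reached
      height \<open>\<bar>y\<bar>\<close> by time \<open>M\<close>, and symmetrically at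
      \<open>-M\<close>; the intermediate value theorem does the rest.\<close>
    define M where "M = \<bar>y\<bar> / (1 - \<alpha>)"
    have M: "M \<ge> 0" "(1 - \<alpha>) * M = \<bar>y\<bar>" using \<alpha> by (auto simp: M_def)
    have "h (-M) \<le> y" "y \<le> h M"
      using Rep_alpha_bound[OF h, of M 0] Rep_alpha_bound[OF h, of "-M" 0] M h0
      by (simp_all add: algebra_simps)
    then obtain x where "h x = y"
      using IVT'[of h "-M" y M] M(1) continuous_on_subset[OF cont] by auto
    then show ?thesis by blast
  qed
  then show ?thesis by (metis surjI)
qed

text \<open>Slopes bounded below by \<open>1 - \<alpha>\<close> make the inverse Lipschitz. This is
  what reduces the third statement of the theorem to the second: both speak of the same
  sets.\<close>

lemma Rep_alpha_subset_Rep: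
  assumes "\<alpha> < 1"
  shows "Rep_alpha \<alpha> \<subseteq> Rep"
proof
  fix h assume h: "h \<in> Rep_alpha \<alpha>"
  have inj: "inj h" by (rule strict_mono_imp_inj_on[OF Rep_alpha_strict_mono[OF h assms]])
  have surj: "surj h" by (rule Rep_alpha_surj[OF h assms])
  have hc: "h \<in> C00" using h by (simp add: Rep_alpha_def)
  have "(1 / (1 - \<alpha>))-lipschitz_on UNIV (inv h)"
  proof (rule lipschitz_onI)
    show "dist (inv h x) (inv h y) \<le> 1 / (1 - \<alpha>) * dist x y" for x y
      using Rep_alpha_expands[OF h, of "inv h x" "inv h y"] assms
      by (simp add: surj_f_inv_f[OF surj] dist_real_def pos_le_divide_eq mult.commute)
  qed (use assms in simp)
  then have "continuous_on UNIV (inv h)" by (rule lipschitz_on_continuous_on)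
  then have "homeomorphism UNIV UNIV h (inv h)"
    using hc inj surj by (auto simp: homeomorphism_def C00_def surj_f_inv_f inj_imp_surj_inv)
  then show "h \<in> Rep" using hc Rep_alpha_strict_mono[OF h assms] by (auto simp: Rep_def)
qed

text \<open>The witness is \<open>k \<circ> inv h\<close>. Increments of \<open>h\<close> and
  \<open>k\<close> differ by at most \<open>2/5 * \<bar>s - t\<bar>\<close>, while \<open>h\<close>
  expands by at least \<open>4/5\<close>; the ratio of the two is \<open>1/2\<close>, which explains
  the constant \<open>1/5\<close>.\<close>

lemma Rep_alpha_quotient:
  assumes h: "h \<in> Rep_alpha (1/5)" and k: "k \<in> Rep_alpha (1/5)"
  obtains m where "m \<in> Rep_alpha (1/2)" "\<And>s. m (h s) = k s"
proof
  have surj: "surj h" by (rule Rep_alpha_surj[OF h]) simp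
  have inj: "inj h" by (rule strict_mono_imp_inj_on[OF Rep_alpha_strict_mono[OF h]]) simp
  show m: "(k \<circ> inv h) (h s) = k s" for s by (simp add: inv_f_f[OF inj])
  show "k \<circ> inv h \<in> Rep_alpha (1/2)"
  proof (rule Rep_alphaI)
    have "h 0 = 0" "k 0 = 0" using h k by (auto simp: Rep_alpha_def C00_def)
    then show "(k \<circ> inv h) 0 = 0" using m[of 0] by simp
    show "\<bar>(k \<circ> inv h) a - (k \<circ> inv h) b - (a - b)\<bar> \<le> 1/2 * \<bar>a - b\<bar>" for a b
    proof -
      obtain s t where st: "a = h s" "b = h t" using surj by (metis surj_def)
      show ?thesis
        using Rep_alpha_bound[OF h, of s t] Rep_alpha_bound[OF k, of s t] Rep_alpha_expands[OF h, of s t]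
          abs_triangle_ineq4[of "k s - k t - (s - t)" "h s - h t - (s - t)"]
        unfolding st m by (simp add: algebra_simps)
    qed
  qed
qed

text \<open>The sliding average of \<open>h\<close> over windows of length \<open>T\<close> has derivative \<open>(h (s + T) - h s) / T\<close>.\<close>

lemma sliding_average:
  assumes h: "h \<in> C00" and T: "0 < T"
    and drift: "\<And>s u. 0 \<le> u \<Longrightarrow> u \<le> T \<Longrightarrow> \<bar>h (s + u) - h s - u\<bar> \<le> \<eta>"
  obtains k where "k \<in> Rep_alpha (\<eta> / T)" "\<And>s. \<bar>k s - h s\<bar> \<le> 2 * \<eta>"
proof -
  have cont: "isCont h x" for x using h by (auto simp: C00_def continuous_on_eq_continuous_at)
  obtain H where "\<And>x. (H has_vector_derivative h x) (at x)"
    using einterval_antiderivative[of "-\<infinity>" \<infinity> h] cont by auto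
  then have H: "(H has_real_derivative h x) (at x)" for x
    by (simp add: has_real_derivative_iff_has_vector_derivative)
  \<comment> \<open>The mean of \<open>h\<close> over \<open>[s, s + T]\<close>, shifted by its
    value at \<open>s = 0\<close> so that \<open>k 0 = 0\<close>.\<close>
  define k where "k s = (H (s + T) - H s - (H T - H 0)) / T" for s
  \<comment> \<open>If \<open>h\<close> had slope exactly 1 on the window, its integral would be
    \<open>T * h s + T\<^sup>2 / 2\<close>; the drift costs \<open>\<eta> * T\<close>. The
    normalisation at \<open>0\<close> contains the same offset \<open>T\<^sup>2 / 2\<close>, so the
    offset cancels in \<open>k s - h s\<close> at the price of a second error, hence
    \<open>2 * \<eta>\<close>.\<close>
  have mean: "\<bar>H (s + T) - H s - T * h s - T\<^sup>2 / 2\<bar> \<le> \<eta> * T" for s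
  proof -
    have "((\<lambda>u. H (s + u) - u * h s - u\<^sup>2 / 2) has_real_derivative h (s + u) - h s - u) (at u)" for u
      by (auto intro!: derivative_eq_intros DERIV_chain2[OF H])
    then obtain z where z: "0 < z" "z < T"
      "(H (s + T) - T * h s - T\<^sup>2 / 2) - (H (s + 0) - 0 * h s - 0\<^sup>2 / 2) = (T - 0) * (h (s + z) - h s - z)"
      using MVT2[of 0 T "\<lambda>u. H (s + u) - u * h s - u\<^sup>2 / 2" "\<lambda>u. h (s + u) - h s - u"] T by auto
    have "\<bar>T * (h (s + z) - h s - z)\<bar> \<le> \<eta> * T"
      using drift[of z s] z T by (simp add: abs_mult mult.commute[of T] mult_right_mono)
    moreover have "H (s + T) - H s - T * h s - T\<^sup>2 / 2 = T * (h (s + z) - h s - z)" using z(3) by simp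
    ultimately show ?thesis by simp
  qed
  have "(k has_real_derivative (h (s + T) - h s) / T) (at s)" for s
    unfolding k_def using T by (auto intro!: derivative_eq_intros DERIV_chain2[OF H] H)
  then have k': "((\<lambda>s. k s - s) has_real_derivative (h (s + T) - h s) / T - 1) (at s)" for s
    by (auto intro!: derivative_eq_intros)
  show ?thesis
  proof
    show "k \<in> Rep_alpha (\<eta> / T)"
    proof (rule Rep_alphaI)
      show "k 0 = 0" by (simp add: k_def)
      have "norm ((k s - s) - (k t - t)) \<le> \<eta> / T * norm (s - t)" for s t
      proof (rule field_differentiable_bound[OF convex_UNIV])
        show "((\<lambda>s. k s - s) has_real_derivative (h (z + T) - h z) / T - 1) (at z within UNIV)" for z
          using k' by simp
        show "norm ((h (z + T) - h z) / T - 1) \<le> \<eta> / T" for z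
        proof -
          have "(h (z + T) - h z) / T - 1 = (h (z + T) - h z - T) / T" using T by (simp add: field_simps)
          then show ?thesis using drift[of T z] T by (simp add: divide_right_mono)
        qed
      qed auto
      then show "\<bar>k s - k t - (s - t)\<bar> \<le> \<eta> / T * \<bar>s - t\<bar>" for s t
        by (simp add: algebra_simps)
    qed
    show "\<bar>k s - h s\<bar> \<le> 2 * \<eta>" for s
    proof -
      have "h 0 = 0" using h by (simp add: C00_def)
      moreover have "T * (k s - h s) = (H (s + T) - H s - T * h s - T\<^sup>2 / 2) - (H T - H 0 - T\<^sup>2 / 2)"
      proof -
        have "T * k s = H (s + T) - H s - (H T - H 0)" using T by (simp add: k_def)
        then show ?thesis by (simp add: algebra_simps)
      qed
      ultimately have "\<bar>T * (k s - h s)\<bar> \<le> T * (2 * \<eta>)"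
        using mean[of s] mean[of 0] by (simp add: algebra_simps)
      then show ?thesis using T by (simp add: abs_mult)
    qed
  qed
qed

subsection \<open>Charts, tangent vectors and the metric\<close>

text \<open>Membership in the domain is part of the condition because chart maps take arbitrary
  values outside their domains.\<close>

definition chart_ball :: "('m, 'e::real_normed_vector) chart \<Rightarrow> 'e \<Rightarrow> real \<Rightarrow> 'm set" where
  "chart_ball c z \<rho> = {q \<in> chart_dom c. chart_map c q \<in> ball z \<rho>}"

lemma Ck_on_imp_continuous_on: "Ck_on k S f \<Longrightarrow> continuous_on S f"
proof (cases k)
  case (Suc n)
  assume "Ck_on k S f"
  then obtain f' where "\<And>x. x \<in> S \<Longrightarrow> (f has_derivative f' x) (at x)" unfolding Suc by auto
  then show ?thesis by (rule has_derivative_continuous_on[OF has_derivative_at_withinI])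
qed simp

locale smooth_manifold =
  fixes A :: "('m::t2_space, 'e::euclidean_space) chart set"
  assumes atlas: "smooth_atlas A"
begin

lemma chart_open_dom: "c \<in> A \<Longrightarrow> open (chart_dom c)"
  and chart_open_image: "c \<in> A \<Longrightarrow> open (chart_image c)"
  and chart_homeomorphism:
    "c \<in> A \<Longrightarrow> homeomorphism (chart_dom c) (chart_image c) (chart_map c) (chart_inv c)"
  using atlas by (auto simp: smooth_atlas_def is_chart_def)

lemma chart_inv_map: "c \<in> A \<Longrightarrow> q \<in> chart_dom c \<Longrightarrow> chart_inv c (chart_map c q) = q"
  using chart_homeomorphism by (auto simp: homeomorphism_def)

lemma chart_map_inv: "z \<in> chart_image c \<Longrightarrow> chart_map c (chart_inv c z) = z"
  by (rule f_inv_into_f)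

lemma chart_inv_dom: "z \<in> chart_image c \<Longrightarrow> chart_inv c z \<in> chart_dom c"
  by (rule inv_into_into)

lemma chart_continuous_map: "c \<in> A \<Longrightarrow> continuous_on (chart_dom c) (chart_map c)"
  and chart_continuous_inv: "c \<in> A \<Longrightarrow> continuous_on (chart_image c) (chart_inv c)"
  using chart_homeomorphism by (auto simp: homeomorphism_def)

lemma chart_inj: "c \<in> A \<Longrightarrow> inj_on (chart_map c) (chart_dom c)"
  by (metis chart_inv_map inj_onI)

lemma chart_around: obtains c where "c \<in> A" "p \<in> chart_dom c"
  using atlas unfolding smooth_atlas_def by blast

lemma open_chart_preimage:
  assumes "c \<in> A" "open U"
  shows "open {q \<in> chart_dom c. chart_map c q \<in> U}"
  using continuous_open_preimage[OF chart_continuous_map chart_open_dom] assms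
  by (auto simp: vimage_def Int_def)

lemma open_chart_ball: "c \<in> A \<Longrightarrow> open (chart_ball c z \<rho>)"
  unfolding chart_ball_def by (rule open_chart_preimage) auto

lemma open_map_chart:
  assumes "c \<in> A" "open U"
  shows "open (chart_map c ` (chart_dom c \<inter> U))"
proof -
  have "chart_map c ` (chart_dom c \<inter> U) = {z \<in> chart_image c. chart_inv c z \<in> U}"
  proof (intro equalityI subsetI)
    fix z assume "z \<in> {z \<in> chart_image c. chart_inv c z \<in> U}"
    then have "z \<in> chart_image c" "chart_inv c z \<in> U" by simp_all
    then have "chart_inv c z \<in> chart_dom c \<inter> U" "z = chart_map c (chart_inv c z)"
      by (simp_all only: chart_map_inv chart_inv_dom Int_iff)
    then show "z \<in> chart_map c ` (chart_dom c \<inter> U)" by blast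
  qed (use assms chart_inv_map in auto)
  also have "open \<dots>"
    using continuous_open_preimage[OF chart_continuous_inv chart_open_image] assms
    by (auto simp: vimage_def Int_def)
  finally show ?thesis .
qed

section \<open>Transition maps and coordinates of tangent vectors\<close>

lemma transition_map: "c \<in> A \<Longrightarrow> q \<in> chart_dom c \<Longrightarrow> transition c c' (chart_map c q) = chart_map c' q"
  by (simp add: transition_def chart_inv_map)

lemma smooth_transition:
  "c \<in> A \<Longrightarrow> c' \<in> A \<Longrightarrow> smooth_on (chart_map c ` (chart_dom c \<inter> chart_dom c')) (transition c c')"
  using atlas by (auto simp: smooth_atlas_def)

lemma transition_has_derivative:
  assumes "c \<in> A" "c' \<in> A" "q \<in> chart_dom c" "q \<in> chart_dom c'"
  shows "(transition c c' has_derivative frechet_derivative (transition c c') (at (chart_map c q)))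
    (at (chart_map c q))"
proof -
  have "Ck_on 1 (chart_map c ` (chart_dom c \<inter> chart_dom c')) (transition c c')"
    using smooth_transition[OF assms(1,2)] by (simp only: smooth_on_def)
  then have "transition c c' differentiable (at (chart_map c q))"
    using assms by (auto simp: differentiable_def)
  then show ?thesis by (rule frechet_derivative_works[THEN iffD1])
qed

text \<open>\<open>Ck_on\<close> only provides some derivative with continuous directional values;
  uniqueness of derivatives identifies it with \<open>frechet_derivative\<close>.\<close>

lemma continuous_on_frechet_transition:
  assumes "c \<in> A" "c' \<in> A"
  shows "continuous_on (chart_map c ` (chart_dom c \<inter> chart_dom c'))
    (\<lambda>z. frechet_derivative (transition c c') (at z) u)"
proof -
  have "Ck_on 1 (chart_map c ` (chart_dom c \<inter> chart_dom c')) (transition c c')"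
    using smooth_transition[OF assms(1,2)] by (simp only: smooth_on_def)
  then obtain f' where f': "\<And>x. x \<in> chart_map c ` (chart_dom c \<inter> chart_dom c') \<Longrightarrow>
      (transition c c' has_derivative f' x) (at x)"
      "\<And>v. continuous_on (chart_map c ` (chart_dom c \<inter> chart_dom c')) (\<lambda>x. f' x v)" by auto
  show ?thesis
    by (rule continuous_on_eq[OF f'(2)[of u]]) (metis f'(1) frechet_derivative_at)
qed

text \<open>The cocycle identity, by the chain rule: composing the two transitions gives the direct
  one on an open neighbourhood of the point, which suffices for the derivative.\<close>

lemma transition_chain:
  assumes "c \<in> A" "c' \<in> A" "c'' \<in> A" "q \<in> chart_dom c" "q \<in> chart_dom c'" "q \<in> chart_dom c''"
  shows "frechet_derivative (transition c c'') (at (chart_map c q)) u =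
    frechet_derivative (transition c' c'') (at (chart_map c' q))
      (frechet_derivative (transition c c') (at (chart_map c q)) u)"
proof -
  let ?D1 = "frechet_derivative (transition c c') (at (chart_map c q))"
  let ?D2 = "frechet_derivative (transition c' c'') (at (chart_map c' q))"
  have "(transition c' c'' \<circ> transition c c' has_derivative ?D2 \<circ> ?D1) (at (chart_map c q))"
    by (rule diff_chain_at)
      (simp_all add: transition_map transition_has_derivative assms)
  then have "(transition c c'' has_derivative ?D2 \<circ> ?D1) (at (chart_map c q))"
  proof (rule has_derivative_transform_within_open)
    show "open (chart_map c ` (chart_dom c \<inter> chart_dom c'))"
      using assms by (intro open_map_chart chart_open_dom)
    show "chart_map c q \<in> chart_map c ` (chart_dom c \<inter> chart_dom c')" using assms by auto
    show "(transition c' c'' \<circ> transition c c') z = transition c c'' z"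
      if z: "z \<in> chart_map c ` (chart_dom c \<inter> chart_dom c')" for z
    proof -
      obtain p where "z = chart_map c p" "p \<in> chart_dom c \<inter> chart_dom c'" using z by (rule imageE)
      then show ?thesis by (simp add: transition_map assms)
    qed
  qed
  then have "?D2 \<circ> ?D1 = frechet_derivative (transition c c'') (at (chart_map c q))"
    by (rule frechet_derivative_at)
  then show ?thesis by (metis comp_apply)
qed

lemma transition_self:
  assumes "c \<in> A" "q \<in> chart_dom c"
  shows "frechet_derivative (transition c c) (at (chart_map c q)) u = u"
proof -
  have "(transition c c has_derivative (\<lambda>x. x)) (at (chart_map c q))"
  proof (rule has_derivative_transform_within_open[OF has_derivative_ident])
    show "open (chart_image c)" using assms chart_open_image by auto
    show "z = transition c c z" if "z \<in> chart_image c" for z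
      using that by (simp add: transition_def chart_map_inv)
  qed (use assms in auto)
  from frechet_derivative_at[OF this] show ?thesis by (rule fun_cong[symmetric])
qed

text \<open>Together with \<open>coord_vec_tangent\<close> and \<open>coord_vec_self\<close>, this
  identifies the tangent space with the model space through any one chart.\<close>

lemma tangent_eq_coord_vec:
  assumes "v \<in> tangent_space A q" "c \<in> A" "q \<in> chart_dom c"
  shows "v = coord_vec A c q (v c)"
proof (rule ext)
  fix c'
  show "v c' = coord_vec A c q (v c) c'"
  proof (cases "c' \<in> A \<and> q \<in> chart_dom c'")
    case True
    have "v c' = frechet_derivative (transition c c') (at (chart_map c q)) (v c)"
      using assms(1)[unfolded tangent_space_def mem_Collect_eq, THEN conjunct1, rule_format,
          OF assms(2) _ assms(3), of c'] True by blast
    then show ?thesis using True unfolding coord_vec_def by (simp only: simp_thms if_True)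
  next
    case False
    then have "v c' = 0"
      using assms(1)[unfolded tangent_space_def mem_Collect_eq, THEN conjunct2] by blast
    then show ?thesis using False unfolding coord_vec_def by (simp only: if_False)
  qed
qed

lemma coord_vec_tangent:
  assumes "c \<in> A" "q \<in> chart_dom c"
  shows "coord_vec A c q u \<in> tangent_space A q"
  unfolding tangent_space_def coord_vec_def
proof (intro CollectI conjI allI ballI impI)
  fix c' c'' assume *: "c' \<in> A" "c'' \<in> A" "q \<in> chart_dom c'" "q \<in> chart_dom c''"
  show "(if c'' \<in> A \<and> q \<in> chart_dom c''
      then frechet_derivative (transition c c'') (at (chart_map c q)) u else 0) =
    frechet_derivative (transition c' c'') (at (chart_map c' q))
      (if c' \<in> A \<and> q \<in> chart_dom c'
       then frechet_derivative (transition c c') (at (chart_map c q)) u else 0)"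
    using transition_chain[OF assms(1) *(1,2) assms(2) *(3,4), of u] * by (simp only: simp_thms if_True)
qed (simp only: if_False)

lemma coord_vec_self: "c \<in> A \<Longrightarrow> q \<in> chart_dom c \<Longrightarrow> coord_vec A c q u c = u"
  by (simp add: coord_vec_def transition_self)

lemma coord_vec_combination:
  assumes "c \<in> A" "q \<in> chart_dom c"
  shows "coord_vec A c q (a *\<^sub>R u + b *\<^sub>R v) =
    (\<lambda>c'. a *\<^sub>R coord_vec A c q u c' + b *\<^sub>R coord_vec A c q v c')"
proof (rule ext)
  fix c'
  show "coord_vec A c q (a *\<^sub>R u + b *\<^sub>R v) c' = a *\<^sub>R coord_vec A c q u c' + b *\<^sub>R coord_vec A c q v c'"
  proof (cases "c' \<in> A \<and> q \<in> chart_dom c'")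
    case True
    then have "linear (frechet_derivative (transition c c') (at (chart_map c q)))"
      using has_derivative_linear[OF transition_has_derivative[OF assms(1) _ assms(2)]] by blast
    then show ?thesis using True by (simp add: coord_vec_def linear_add linear_scale)
  qed (simp only: coord_vec_def if_False scaleR_zero_right add_0_left)
qed

end

section \<open>The metric in coordinates\<close>

locale riemannian_manifold = smooth_manifold A
  for A :: "('m::t2_space, 'e::euclidean_space) chart set" +
  fixes g :: "'m \<Rightarrow> ('m, 'e) tvec \<Rightarrow> ('m, 'e) tvec \<Rightarrow> real"
  assumes metric: "riemannian_metric A g"
begin

text \<open>\<open>riemannian_metric\<close> constrains \<open>g\<close> on tangent vectors only, so
  bilinearity is stated after pulling back along \<open>coord_vec\<close>; boundedness is automatic
  in finite dimension.\<close>

lemma metric_bilinear: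
  assumes "c \<in> A" "q \<in> chart_dom c"
  shows "bounded_bilinear (\<lambda>u v. g q (coord_vec A c q u) (coord_vec A c q v))"
proof -
  have sym: "g q u v = g q v u" if "u \<in> tangent_space A q" "v \<in> tangent_space A q" for u v
    using metric that by (simp add: riemannian_metric_def)
  have lin: "g q (\<lambda>c. a *\<^sub>R u c + b *\<^sub>R v c) w = a * g q u w + b * g q v w"
    if "u \<in> tangent_space A q" "v \<in> tangent_space A q" "w \<in> tangent_space A q" for u v w a b
    using metric that by (simp add: riemannian_metric_def)
  have "linear (\<lambda>u. g q (coord_vec A c q u) (coord_vec A c q w))" for w
  proof (rule linearI)
    show "g q (coord_vec A c q (x + y)) (coord_vec A c q w) =
      g q (coord_vec A c q x) (coord_vec A c q w) + g q (coord_vec A c q y) (coord_vec A c q w)" for x y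
      using coord_vec_combination[OF assms, of 1 x 1 y]
        lin[of "coord_vec A c q x" "coord_vec A c q y" "coord_vec A c q w" 1 1]
      by (simp add: coord_vec_tangent assms)
    show "g q (coord_vec A c q (r *\<^sub>R x)) (coord_vec A c q w) =
      r *\<^sub>R g q (coord_vec A c q x) (coord_vec A c q w)" for r x
      using coord_vec_combination[OF assms, of r x 0 x]
        lin[of "coord_vec A c q x" "coord_vec A c q x" "coord_vec A c q w" r 0]
      by (simp add: coord_vec_tangent assms)
  qed
  then show ?thesis
    using sym coord_vec_tangent[OF assms] by (simp add: bilinear_def flip: bilinear_conv_bounded_bilinear)
qed

text \<open>Smoothness is given for fixed coordinate vectors. Joint continuity in base point and
  vector follows by expanding the form in the finite basis.\<close>

lemma metric_continuous:
  assumes c: "c \<in> A"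
  shows "continuous_on (chart_image c \<times> UNIV)
    (\<lambda>(z, u). g (chart_inv c z) (coord_vec A c (chart_inv c z) u) (coord_vec A c (chart_inv c z) u))"
proof -
  let ?G = "\<lambda>z u v. g (chart_inv c z) (coord_vec A c (chart_inv c z) u) (coord_vec A c (chart_inv c z) v)"
  have cont: "continuous_on (chart_image c) (\<lambda>z. ?G z u v)" for u v
  proof -
    have "smooth_on (chart_image c) (\<lambda>z. ?G z u v)"
      using metric c unfolding riemannian_metric_def by blast
    then show ?thesis unfolding smooth_on_def by (blast intro: Ck_on_imp_continuous_on)
  qed
  have expand: "(\<Sum>i\<in>Basis. \<Sum>j\<in>Basis. (u \<bullet> i) * (u \<bullet> j) * ?G z i j) = ?G z u u"
    if z: "z \<in> chart_image c" for z u
  proof -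
    interpret bounded_bilinear "?G z"
      by (rule metric_bilinear[OF c chart_inv_dom[OF z]])
    have "?G z u u = ?G z (\<Sum>i\<in>Basis. (u \<bullet> i) *\<^sub>R i) (\<Sum>j\<in>Basis. (u \<bullet> j) *\<^sub>R j)"
      by (simp only: euclidean_representation)
    also have "\<dots> = (\<Sum>i\<in>Basis. \<Sum>j\<in>Basis. (u \<bullet> i) * (u \<bullet> j) * ?G z i j)"
      by (simp only: sum_left scaleR_left)
        (simp only: sum_right scaleR_right real_scaleR_def mult.assoc sum_distrib_left)
    finally show ?thesis by simp
  qed
  have "continuous_on (chart_image c \<times> UNIV)
    (\<lambda>(z, u). \<Sum>i\<in>Basis. \<Sum>j\<in>Basis. (u \<bullet> i) * (u \<bullet> j) * ?G z i j)"
    unfolding case_prod_unfold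
    by (intro continuous_intros continuous_on_compose2[OF cont]) auto
  then show ?thesis
    by (rule continuous_on_eq) (auto simp: expand)
qed

text \<open>The quadratic form is continuous and positive on the compact product of \<open>C\<close>
  with the unit sphere, so it has a positive minimum and a maximum there; homogeneity extends the
  bounds to all vectors.\<close>

lemma metric_comparison:
  assumes c: "c \<in> A" and C: "compact C" "C \<subseteq> chart_image c"
  obtains K where "K \<ge> 1" 
    "\<And>q v. q \<in> chart_dom c \<Longrightarrow> chart_map c q \<in> C \<Longrightarrow> v \<in> tangent_space A q \<Longrightarrow>
       norm (v c) \<le> K * tnorm g q v \<and> tnorm g q v \<le> K * norm (v c)"
proof -
  let ?G = "\<lambda>z u. g (chart_inv c z) (coord_vec A c (chart_inv c z) u) (coord_vec A c (chart_inv c z) u)"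
  let ?S = "C \<times> sphere (0::'e) 1"
  have cont: "continuous_on ?S (\<lambda>(z, u). ?G z u)"
    by (rule continuous_on_subset[OF metric_continuous[OF c]]) (use C in auto)
  have comp: "compact ?S" using C by (intro compact_Times) auto
  have pos: "0 < ?G z u" if "z \<in> C" "u \<noteq> 0" for z u
  proof -
    have z: "z \<in> chart_image c" using that C by auto
    have "coord_vec A c (chart_inv c z) u \<noteq> (\<lambda>c. 0)"
      using coord_vec_self[OF c chart_inv_dom[OF z], of u] that(2) by auto
    then show ?thesis
      using metric coord_vec_tangent[OF c chart_inv_dom[OF z]] unfolding riemannian_metric_def by blast
  qed
  obtain m M where mM: "0 < m" "\<And>z u. z \<in> C \<Longrightarrow> norm u = 1 \<Longrightarrow> m \<le> ?G z u \<and> ?G z u \<le> M"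
  proof (cases "C = {}")
    case False
    \<comment> \<open>Any basis vector witnesses that the unit sphere is nonempty.\<close>
    then have ne: "?S \<noteq> {}" by (auto simp: SOME_Basis intro: exI[of _ "SOME i. i \<in> (Basis::'e set)"])
    obtain x where x: "x \<in> ?S" "\<And>y. y \<in> ?S \<Longrightarrow> (\<lambda>(z, u). ?G z u) x \<le> (\<lambda>(z, u). ?G z u) y"
      using continuous_attains_inf[OF comp ne cont] by blast
    obtain x' where x': "x' \<in> ?S" "\<And>y. y \<in> ?S \<Longrightarrow> (\<lambda>(z, u). ?G z u) y \<le> (\<lambda>(z, u). ?G z u) x'"
      using continuous_attains_sup[OF comp ne cont] by blast
    show ?thesis
    proof (rule that)
      show "0 < (\<lambda>(z, u). ?G z u) x" using x(1) pos[of "fst x" "snd x"] norm_zero by (fastforce simp: case_prod_unfold)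
      show "(\<lambda>(z, u). ?G z u) x \<le> ?G z u \<and> ?G z u \<le> (\<lambda>(z, u). ?G z u) x'"
        if "z \<in> C" "norm u = 1" for z u
        using x(2)[of "(z, u)"] x'(2)[of "(z, u)"] that by auto
    qed
  qed (auto intro: that[of 1])
  define K where "K = max 1 (max (1 / sqrt m) (sqrt (max M 0)))"
  show ?thesis
  proof
    show "K \<ge> 1" by (simp add: K_def)
    fix q v assume q: "q \<in> chart_dom c" "chart_map c q \<in> C" and v: "v \<in> tangent_space A q"
    interpret bounded_bilinear "\<lambda>u v. g q (coord_vec A c q u) (coord_vec A c q v)"
      by (rule metric_bilinear[OF c q(1)])
    have veq: "tnorm g q v = sqrt (g q (coord_vec A c q (v c)) (coord_vec A c q (v c)))"
      unfolding tnorm_def using tangent_eq_coord_vec[OF v c q(1)] by simp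
    show "norm (v c) \<le> K * tnorm g q v \<and> tnorm g q v \<le> K * norm (v c)"
    proof (cases "v c = 0")
      case True
      then show ?thesis unfolding veq by (simp add: zero_left)
    next
      case False
      define u where "u = v c /\<^sub>R norm (v c)"
      have u: "norm u = 1" "v c = norm (v c) *\<^sub>R u" using False by (auto simp: u_def)
      define G where "G = ?G (chart_map c q) u"
      have "tnorm g q v = sqrt (norm (v c) * (norm (v c) * G))"
        unfolding veq
        by (subst u(2), subst (2) u(2)) (simp add: G_def scaleR_left scaleR_right chart_inv_map[OF c q(1)])
      also have "\<dots> = norm (v c) * sqrt G" by (simp add: real_sqrt_mult)
      finally have t: "tnorm g q v = norm (v c) * sqrt G" .
      have G: "m \<le> G" "G \<le> M" using mM(2)[OF q(2) u(1)] by (auto simp: G_def)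
      have "sqrt G \<le> K" using G by (auto simp: K_def le_max_iff_disj)
      moreover have "1 \<le> K * sqrt G"
      proof -
        have "1 = 1 / sqrt m * sqrt m" using mM(1) by simp
        also have "\<dots> \<le> K * sqrt G"
          using mM(1) G by (intro mult_mono) (auto simp: K_def)
        finally show ?thesis .
      qed
      ultimately show ?thesis unfolding t
        by (metis mult.commute mult.left_commute mult_left_mono mult.right_neutral norm_ge_zero)
    qed
  qed
qed

lemma tnorm_nonneg: "v \<in> tangent_space A q \<Longrightarrow> 0 \<le> tnorm g q v"
proof -
  assume v: "v \<in> tangent_space A q"
  obtain c where c: "c \<in> A" "q \<in> chart_dom c" by (rule chart_around)
  obtain K where "K \<ge> 1" "norm (v c) \<le> K * tnorm g q v"
    using metric_comparison[OF c(1), of "{chart_map c q}"] c v by (metis compact_sing empty_subsetI imageI insert_iff insert_subset)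
  then show ?thesis by (smt (verit) norm_ge_zero zero_le_mult_iff)
qed

subsection \<open>Riemannian distance in a chart\<close>

text \<open>Continuity is local, and near each parameter the curve stays in one chart, where
  \<open>metric_continuous\<close> applies. It makes the length integrals exist.\<close>

lemma tnorm_curve_continuous:
  assumes \<gamma>: "C1_curve_on A a b \<gamma> V"
  shows "continuous_on {a..b} (\<lambda>t. tnorm g (\<gamma> t) (V t))"
proof (rule continuous_on_eq_continuous_within[THEN iffD2, rule_format])
  fix t assume t: "t \<in> {a..b}"
  obtain c where c: "c \<in> A" "\<gamma> t \<in> chart_dom c" by (rule chart_around)
  let ?S = "{s \<in> {a..b}. \<gamma> s \<in> chart_dom c}"
  let ?G = "\<lambda>z u. g (chart_inv c z) (coord_vec A c (chart_inv c z) u) (coord_vec A c (chart_inv c z) u)"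
  have cont: "continuous_on {a..b} \<gamma>" and V: "\<And>s. s \<in> {a..b} \<Longrightarrow> V s \<in> tangent_space A (\<gamma> s)"
    and Vc: "continuous_on ?S (\<lambda>s. V s c)"
    using \<gamma> c(1) by (simp_all add: C1_curve_on_def)
  have "continuous_on ?S (\<lambda>s. chart_map c (\<gamma> s))"
    by (rule continuous_on_compose2[OF chart_continuous_map[OF c(1)] continuous_on_subset[OF cont]]) auto
  then have "continuous_on ?S (\<lambda>s. sqrt (case (chart_map c (\<gamma> s), V s c) of (z, u) \<Rightarrow> ?G z u))"
    by (intro continuous_on_real_sqrt continuous_on_compose2[OF metric_continuous[OF c(1)]]
        continuous_on_Pair Vc) auto
  moreover have "sqrt (case (chart_map c (\<gamma> s), V s c) of (z, u) \<Rightarrow> ?G z u) = tnorm g (\<gamma> s) (V s)"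
    if "s \<in> ?S" for s
    using that tangent_eq_coord_vec[OF V c(1), of s] by (simp add: tnorm_def chart_inv_map c(1))
  ultimately have "continuous_on ?S (\<lambda>s. tnorm g (\<gamma> s) (V s))"
    by (rule continuous_on_eq)
  then have "continuous (at t within ?S) (\<lambda>s. tnorm g (\<gamma> s) (V s))"
    using t c(2) by (simp add: continuous_on_eq_continuous_within)
  \<comment> \<open>The parameters mapped into the chart domain form a relatively open set, so
    restricting to them does not change the limit at \<open>t\<close>.\<close>
  moreover have "at t within ?S = at t within {a..b}"
  proof -
    obtain U where U: "open U" "U \<inter> {a..b} = \<gamma> -` chart_dom c \<inter> {a..b}"
      using continuous_on_open_invariant[THEN iffD1, rule_format, OF cont chart_open_dom[OF c(1)]]
      by blast
    then have S: "?S = U \<inter> {a..b}" by blast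
    moreover have "t \<in> ?S" using t c(2) by simp
    ultimately show ?thesis
      by (intro at_within_nhd[of t U]) (use U(1) in auto)
  qed
  ultimately show "continuous (at t within {a..b}) (\<lambda>s. tnorm g (\<gamma> s) (V s))" by simp
qed

lemma C1_curve_tnorm_nonneg: "C1_curve_on A a b \<gamma> V \<Longrightarrow> t \<in> {a..b} \<Longrightarrow> 0 \<le> tnorm g (\<gamma> t) (V t)"
  using tnorm_nonneg[of "V t" "\<gamma> t"] by (simp add: C1_curve_on_def)

lemma C1_curve_length_nonneg:
  assumes "C1_curve_on A a b \<gamma> V"
  shows "0 \<le> integral {a..b} (\<lambda>t. tnorm g (\<gamma> t) (V t))"
  using C1_curve_tnorm_nonneg[OF assms]
  by (intro integral_nonneg integrable_continuous_real tnorm_curve_continuous[OF assms]) auto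

text \<open>A piece of curve whose \<open>K\<close>-fold length does not reach the boundary of the ball cannot exit:
  up to the first exit time the coordinates stay in a compact subset of the ball.\<close>

lemma C1_piece_displacement:
  assumes c: "c \<in> A" and ball: "ball z \<rho> \<subseteq> chart_image c"
    and cmp: "\<And>q v. q \<in> chart_ball c z \<rho> \<Longrightarrow> v \<in> tangent_space A q \<Longrightarrow> norm (v c) \<le> K * tnorm g q v"
    and K: "0 \<le> K" and ab: "a \<le> b" and \<gamma>: "C1_curve_on A a b \<gamma> V"
    and a: "\<gamma> a \<in> chart_dom c"
    and len: "dist z (chart_map c (\<gamma> a)) + K * integral {a..b} (\<lambda>t. tnorm g (\<gamma> t) (V t)) < \<rho>"
  shows "\<gamma> b \<in> chart_ball c z \<rho>"
    and "dist (chart_map c (\<gamma> a)) (chart_map c (\<gamma> b)) \<le> K * integral {a..b} (\<lambda>t. tnorm g (\<gamma> t) (V t))"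
proof -
  let ?B = "chart_ball c z \<rho>"
  define \<Lambda> where "\<Lambda> = integral {a..b} (\<lambda>t. tnorm g (\<gamma> t) (V t))"
  \<comment> \<open>The compact set that confines the coordinates: the length hypothesis puts it
    inside the open ball.\<close>
  define C where "C = cball (chart_map c (\<gamma> a)) (K * \<Lambda>)"
  have cont: "continuous_on {a..b} \<gamma>" and V: "\<And>s. s \<in> {a..b} \<Longrightarrow> V s \<in> tangent_space A (\<gamma> s)"
    and deriv: "\<And>t. t \<in> {a..b} \<Longrightarrow> \<gamma> t \<in> chart_dom c \<Longrightarrow>
      ((\<lambda>s. chart_map c (\<gamma> s)) has_vector_derivative V t c) (at t within {a..b})"
    using \<gamma> c(1) by (simp_all add: C1_curve_on_def)
  have C: "C \<subseteq> ball z \<rho>"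
  proof
    fix w assume "w \<in> C"
    then show "w \<in> ball z \<rho>"
      using dist_triangle[of z w "chart_map c (\<gamma> a)"] len by (simp add: C_def \<Lambda>_def)
  qed
  have tn: "(\<lambda>t. tnorm g (\<gamma> t) (V t)) integrable_on {a..s}" if "s \<in> {a..b}" for s
    using that by (intro integrable_continuous_real continuous_on_subset[OF tnorm_curve_continuous[OF \<gamma>]]) auto
  have disp: "chart_map c (\<gamma> s) \<in> C"
    if s: "s \<in> {a..b}" and in_B: "\<And>t. t \<in> {a..s} \<Longrightarrow> \<gamma> t \<in> ?B" for s
  proof -
    have hi: "((\<lambda>t. V t c) has_integral chart_map c (\<gamma> s) - chart_map c (\<gamma> a)) {a..s}"
    proof (rule fundamental_theorem_of_calculus)
      show "((\<lambda>s. chart_map c (\<gamma> s)) has_vector_derivative V t c) (at t within {a..s})"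
        if "t \<in> {a..s}" for t
        using has_vector_derivative_within_subset[OF deriv[of t], of "{a..s}"] that in_B[OF that] s
        by (auto simp: chart_ball_def)
    qed (use s in auto)
    then have int: "(\<lambda>t. V t c) integrable_on {a..s}" by (rule has_integral_integrable)
    have "norm (chart_map c (\<gamma> s) - chart_map c (\<gamma> a)) = norm (integral {a..s} (\<lambda>t. V t c))"
      by (simp add: integral_unique[OF hi])
    also have "\<dots> \<le> integral {a..s} (\<lambda>t. K * tnorm g (\<gamma> t) (V t))"
    proof (rule integral_norm_bound_integral[OF int])
      show "(\<lambda>t. K * tnorm g (\<gamma> t) (V t)) integrable_on {a..s}"
        using tn[OF s] by (rule integrable_on_mult_right)
      show "norm (V t c) \<le> K * tnorm g (\<gamma> t) (V t)" if "t \<in> {a..s}" for t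
        using cmp[OF in_B[OF that] V] that s by auto
    qed
    also have "\<dots> = K * integral {a..s} (\<lambda>t. tnorm g (\<gamma> t) (V t))" by simp
    also have "\<dots> \<le> K * \<Lambda>"
      unfolding \<Lambda>_def using s ab C1_curve_tnorm_nonneg[OF \<gamma>]
      by (intro mult_left_mono K integral_subset_le tn) auto
    finally show ?thesis by (simp add: C_def dist_norm norm_minus_commute)
  qed
  have B: "\<gamma> t \<in> ?B" if "t \<in> {a..b}" for t
  proof (rule ccontr)
    assume "\<gamma> t \<notin> ?B"
    define Z where "Z = {a..b} \<inter> \<gamma> -` (- ?B)"
    have "closed (- ?B)" using open_chart_ball[OF c] by (simp add: closed_def)
    then have "compact Z"
      unfolding Z_def
      by (metis closed_atLeastAtMost cont compact_Icc compact_Int_closed continuous_closed_preimage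
          inf.idem inf_assoc)
    moreover have "Z \<noteq> {}" using that \<open>\<gamma> t \<notin> ?B\<close> by (auto simp: Z_def)
    ultimately obtain e where e: "e \<in> Z" "\<And>s. s \<in> Z \<Longrightarrow> e \<le> s"
      using compact_attains_inf by metis
    have "\<gamma> a \<in> ?B"
      using a len K C1_curve_length_nonneg[OF \<gamma>]
      by (auto simp: chart_ball_def intro: le_less_trans[rotated])
    then have "a < e" using e(1) ab by (cases "e = a") (auto simp: Z_def)
    have before: "chart_map c (\<gamma> s) \<in> C" "\<gamma> s \<in> ?B" if "s \<in> {a..<e}" for s
    proof -
      have "\<gamma> t \<in> ?B" if "t \<in> {a..s}" for t
        using e(2)[of t] that \<open>s \<in> {a..<e}\<close> e(1) by (force simp: Z_def)
      then show "chart_map c (\<gamma> s) \<in> C" "\<gamma> s \<in> ?B"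
        using disp[of s] that e(1) by (auto simp: Z_def)
    qed
    \<comment> \<open>A priori \<open>\<gamma> e\<close> could lie outside the chart domain, so the
      limit is taken in the manifold: the image of \<open>C\<close> under \<open>chart_inv c\<close>
      is compact, hence closed in a Hausdorff space, and contains \<open>\<gamma> s\<close> for all
      \<open>s\<close> before \<open>e\<close>.\<close>
    have "compact (chart_inv c ` C)"
      using C ball by (intro compact_continuous_image continuous_on_subset[OF chart_continuous_inv[OF c]])
        (auto simp: C_def)
    then have "closed ({a..e} \<inter> \<gamma> -` (chart_inv c ` C))"
      using e(1) by (intro continuous_closed_preimage compact_imp_closed continuous_on_subset[OF cont])
        (auto simp: Z_def)
    moreover have "{a..<e} \<subseteq> {a..e} \<inter> \<gamma> -` (chart_inv c ` C)"
    proof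
      fix s assume s: "s \<in> {a..<e}"
      have "\<gamma> s = chart_inv c (chart_map c (\<gamma> s))"
        using before(2)[OF s] chart_inv_map[OF c] by (simp add: chart_ball_def)
      then show "s \<in> {a..e} \<inter> \<gamma> -` (chart_inv c ` C)" using before(1)[OF s] s by auto
    qed
    ultimately have "closure {a..<e} \<subseteq> {a..e} \<inter> \<gamma> -` (chart_inv c ` C)"
      by (rule closure_minimal[rotated])
    moreover have "e \<in> closure {a..<e}" using \<open>a < e\<close> by (simp add: closure_atLeastLessThan)
    ultimately have "e \<in> {a..e} \<inter> \<gamma> -` (chart_inv c ` C)" by (rule subsetD)
    then have "\<gamma> e \<in> chart_inv c ` C" by simp
    then obtain w where w: "\<gamma> e = chart_inv c w" "w \<in> C" by (rule imageE)
    have "w \<in> chart_image c" using w C ball by auto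
    then have "\<gamma> e \<in> ?B"
      using w C chart_map_inv[of w c] chart_inv_dom[of w c] by (auto simp: chart_ball_def)
    then show False using e(1) by (simp add: Z_def)
  qed
  show "\<gamma> b \<in> ?B" using B[of b] ab by simp
  show "dist (chart_map c (\<gamma> a)) (chart_map c (\<gamma> b)) \<le> K * integral {a..b} (\<lambda>t. tnorm g (\<gamma> t) (V t))"
    using disp[of b] B ab by (simp add: C_def \<Lambda>_def)
qed

text \<open>Induction over the break points: partial sums of the lengths never exceed
  \<open>L\<close>, so the slack in \<open>len\<close> is still available at the start of each
  piece.\<close>

lemma curve_displacement:
  assumes c: "c \<in> A" and ball: "ball z \<rho> \<subseteq> chart_image c"
    and cmp: "\<And>q v. q \<in> chart_ball c z \<rho> \<Longrightarrow> v \<in> tangent_space A q \<Longrightarrow> norm (v c) \<le> K * tnorm g q v"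
    and K: "0 \<le> K" and \<gamma>: "curve_has_length A g \<gamma> L"
    and dom: "\<gamma> 0 \<in> chart_dom c" and len: "dist z (chart_map c (\<gamma> 0)) + K * L < \<rho>"
  shows "\<gamma> 1 \<in> chart_ball c z \<rho>" and "dist (chart_map c (\<gamma> 0)) (chart_map c (\<gamma> 1)) \<le> K * L"
proof -
  obtain n :: nat and \<tau> :: "nat \<Rightarrow> real" and V where \<tau>: "\<tau> 0 = 0" "\<tau> n = 1"
    and piece: "\<And>i. i < n \<Longrightarrow> \<tau> i < \<tau> (Suc i)" "\<And>i. i < n \<Longrightarrow> C1_curve_on A (\<tau> i) (\<tau> (Suc i)) \<gamma> (V i)"
    and L: "L = (\<Sum>i<n. integral {\<tau> i..\<tau> (Suc i)} (\<lambda>t. tnorm g (\<gamma> t) (V i t)))"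
    using \<gamma> unfolding curve_has_length_def by blast
  define l where "l i = integral {\<tau> i..\<tau> (Suc i)} (\<lambda>t. tnorm g (\<gamma> t) (V i t))" for i
  have l: "0 \<le> l i" if "i < n" for i
    unfolding l_def by (rule C1_curve_length_nonneg[OF piece(2)[OF that]])
  have nn: "0 \<le> (\<Sum>i<j. l i)" if "j \<le> n" for j
    using l that by (intro sum_nonneg) auto
  have le: "(\<Sum>i<j. l i) \<le> L" if "j \<le> n" for j
    unfolding L l_def[symmetric] using l that by (intro sum_mono2) auto
  have "\<gamma> (\<tau> j) \<in> chart_ball c z \<rho> \<and> dist (chart_map c (\<gamma> 0)) (chart_map c (\<gamma> (\<tau> j))) \<le> K * (\<Sum>i<j. l i)"
    if "j \<le> n" for j
    using that
  proof (induction j)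
    case 0
    have "0 \<le> K * L" using K nn[of n] le[of n] by simp
    then show ?case using dom len by (simp add: chart_ball_def \<tau>)
  next
    case (Suc j)
    let ?p = "chart_map c (\<gamma> 0)" and ?q = "chart_map c (\<gamma> (\<tau> j))" and ?r = "chart_map c (\<gamma> (\<tau> (Suc j)))"
    have IH: "\<gamma> (\<tau> j) \<in> chart_ball c z \<rho>" "dist ?p ?q \<le> K * (\<Sum>i<j. l i)"
      using Suc by auto
    have j: "j < n" using Suc.prems by simp
    have "dist z ?q + K * l j \<le> dist z ?p + (K * (\<Sum>i<j. l i) + K * l j)"
      using IH(2) dist_triangle[of z ?q ?p] by linarith
    also have "K * (\<Sum>i<j. l i) + K * l j = K * (\<Sum>i<Suc j. l i)" by (simp add: algebra_simps)
    also have "dist z ?p + \<dots> \<le> dist z ?p + K * L"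
      using le[OF Suc.prems] K by (intro add_left_mono mult_left_mono)
    finally have *: "dist z ?q + K * l j < \<rho>" using len by simp
    have "\<gamma> (\<tau> j) \<in> chart_dom c" using IH(1) by (simp add: chart_ball_def)
    note step = C1_piece_displacement[OF c ball cmp K less_imp_le[OF piece(1)[OF j]] piece(2)[OF j] this,
      folded l_def, OF _ _ *]
    have "dist ?p ?r \<le> dist ?p ?q + dist ?q ?r" by (rule dist_triangle)
    also have "\<dots> \<le> K * (\<Sum>i<j. l i) + K * l j" using IH(2) step(2) by (rule add_mono)
    finally have "dist ?p ?r \<le> K * (\<Sum>i<Suc j. l i)" by (simp add: algebra_simps)
    then show ?case using step(1) by blast
  qed
  from this[of n] show "\<gamma> 1 \<in> chart_ball c z \<rho>" "dist (chart_map c (\<gamma> 0)) (chart_map c (\<gamma> 1)) \<le> K * L"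
    by (simp_all add: \<tau> L l_def)
qed

text \<open>The infimum defining the distance need not be attained, so the estimate is applied to a
  curve of length below \<open>r + d\<close>, and then the excess is let go to zero.\<close>

lemma rdist_lower:
  assumes c: "c \<in> A" and ball: "ball z \<rho> \<subseteq> chart_image c"
    and cmp: "\<And>q v. q \<in> chart_ball c z \<rho> \<Longrightarrow> v \<in> tangent_space A q \<Longrightarrow> norm (v c) \<le> K * tnorm g q v"
    and K: "0 \<le> K" and dom: "q \<in> chart_dom c" and len: "dist z (chart_map c q) + K * r < \<rho>"
    and r: "0 \<le> r" "rdist A g q q' \<le> ennreal r"
  shows "q' \<in> chart_ball c z \<rho>" and "dist (chart_map c q) (chart_map c q') \<le> K * r"
proof -
  define gap where "gap = \<rho> - (dist z (chart_map c q) + K * r)"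
  have gap: "0 < gap" using len by (simp add: gap_def)
  have *: "q' \<in> chart_ball c z \<rho> \<and> dist (chart_map c q) (chart_map c q') \<le> K * r + e" if "0 < e" for e
  proof -
    \<comment> \<open>Small enough that \<open>K * d\<close> is at most \<open>e\<close> and below
      the slack \<open>gap\<close>; \<open>K + 1\<close> guards against
      \<open>K = 0\<close>.\<close>
    define d where "d = min e gap / (2 * (K + 1))"
    have d: "0 < d" using that gap K by (simp add: d_def)
    have "K * d \<le> (K + 1) * d" using d by simp
    also have "\<dots> = min e gap / 2" using K by (simp add: d_def field_simps)
    finally have Kd: "K * d \<le> e" "K * d < gap" using that gap by auto
    have "rdist A g q q' < ennreal (r + d)"
      using r d by (intro le_less_trans[OF r(2)]) (simp add: ennreal_less_iff)
    then obtain L \<gamma> where L: "ennreal L < ennreal (r + d)" "\<gamma> 0 = q" "\<gamma> 1 = q'" "curve_has_length A g \<gamma> L"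
      unfolding rdist_def Inf_less_iff by auto
    have "L \<le> r + d" using L(1) r d by (smt (verit) ennreal_leI not_less)
    then have KL: "K * L \<le> K * r + K * d" using K by (metis distrib_left mult_left_mono)
    then have "dist z (chart_map c (\<gamma> 0)) + K * L < \<rho>" using Kd(2) by (simp add: gap_def L(2))
    then show ?thesis
      using curve_displacement[OF c ball cmp K L(4)] dom KL Kd(1) by (force simp: L(2,3))
  qed
  show "q' \<in> chart_ball c z \<rho>" using *[of 1] by simp
  show "dist (chart_map c q) (chart_map c q') \<le> K * r"
    using * by (blast intro: field_le_epsilon)
qed

text \<open>The competitor is the straight coordinate segment, which stays in the ball by convexity
  and has constant velocity \<open>w\<close> in the chart \<open>c\<close>.\<close>

lemma rdist_upper:
  assumes c: "c \<in> A" and ball: "ball z \<rho> \<subseteq> chart_image c"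
    and cmp: "\<And>q v. q \<in> chart_ball c z \<rho> \<Longrightarrow> v \<in> tangent_space A q \<Longrightarrow> tnorm g q v \<le> K * norm (v c)"
    and q: "q \<in> chart_ball c z \<rho>" "q' \<in> chart_ball c z \<rho>"
  shows "rdist A g q q' \<le> ennreal (K * dist (chart_map c q) (chart_map c q'))"
proof -
  define w where "w = chart_map c q' - chart_map c q"
  define seg where "seg s = chart_map c q + s *\<^sub>R w" for s
  define \<gamma> where "\<gamma> s = chart_inv c (seg s)" for s
  define V where "V s = coord_vec A c (\<gamma> s) w" for s
  have seg: "seg s \<in> ball z \<rho>" if "s \<in> {0..1}" for s
  proof -
    have "seg s = (1 - s) *\<^sub>R chart_map c q + s *\<^sub>R chart_map c q'"
      by (simp add: seg_def w_def algebra_simps)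
    then show ?thesis
      using q that convexD_alt[OF convex_ball, of "chart_map c q" z \<rho> "chart_map c q'" s]
      by (simp add: chart_ball_def)
  qed
  have im: "seg s \<in> chart_image c" if "s \<in> {0..1}" for s
    using seg[OF that] ball by blast
  have dom: "\<gamma> s \<in> chart_dom c" and map: "chart_map c (\<gamma> s) = seg s" if "s \<in> {0..1}" for s
    unfolding \<gamma>_def using chart_inv_dom[OF im[OF that]] chart_map_inv[OF im[OF that]] by auto
  have "continuous_on {0..1} seg" unfolding seg_def by (intro continuous_intros)
  have curve: "C1_curve_on A 0 1 \<gamma> V"
    unfolding C1_curve_on_def
  proof (intro conjI ballI impI)
    show "continuous_on {0..1} \<gamma>"
      unfolding \<gamma>_def
      by (rule continuous_on_compose2[OF chart_continuous_inv[OF c] \<open>continuous_on {0..1} seg\<close>])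
        (use im in blast)
    show "V t \<in> tangent_space A (\<gamma> t)" if "t \<in> {0..1}" for t
      unfolding V_def by (rule coord_vec_tangent[OF c dom[OF that]])
  next
    fix c' t assume c': "c' \<in> A" and t: "t \<in> {0..1}" and dom': "\<gamma> t \<in> chart_dom c'"
    have "(seg has_derivative (\<lambda>x. x *\<^sub>R w)) (at t within {0..1})"
      unfolding seg_def by (auto intro!: derivative_eq_intros)
    moreover have "(transition c c' has_derivative frechet_derivative (transition c c') (at (seg t))) (at (seg t))"
      using transition_has_derivative[OF c c' dom[OF t] dom'] by (simp add: map[OF t])
    ultimately have D: "((\<lambda>s. transition c c' (seg s)) has_derivative
        (\<lambda>x. frechet_derivative (transition c c') (at (seg t)) (x *\<^sub>R w))) (at t within {0..1})"
      by (rule has_derivative_compose)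
    have "linear (frechet_derivative (transition c c') (at (seg t)))"
      using transition_has_derivative[OF c c' dom[OF t] dom'] has_derivative_linear map[OF t] by metis
    then have "frechet_derivative (transition c c') (at (seg t)) (x *\<^sub>R w) = x *\<^sub>R V t c'" for x
      using c' dom' by (simp add: linear_scale V_def coord_vec_def map[OF t])
    then show "((\<lambda>s. chart_map c' (\<gamma> s)) has_vector_derivative V t c') (at t within {0..1})"
      using D by (simp add: has_vector_derivative_def transition_def \<gamma>_def)
  next
    fix c' assume c': "c' \<in> A"
    let ?S = "{t \<in> {0..1}. \<gamma> t \<in> chart_dom c'}"
    have "continuous_on ?S (\<lambda>t. frechet_derivative (transition c c') (at (seg t)) w)"
    proof (rule continuous_on_compose2[OF continuous_on_frechet_transition[OF c c']])
      show "continuous_on ?S seg"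
        by (rule continuous_on_subset[OF \<open>continuous_on {0..1} seg\<close>]) auto
      show "seg ` ?S \<subseteq> chart_map c ` (chart_dom c \<inter> chart_dom c')"
      proof (rule image_subsetI)
        fix t assume "t \<in> ?S"
        then have t: "t \<in> {0..1}" "\<gamma> t \<in> chart_dom c \<inter> chart_dom c'" using dom by blast+
        then show "seg t \<in> chart_map c ` (chart_dom c \<inter> chart_dom c')"
          using imageI[OF t(2), of "chart_map c"] by (simp only: map[OF t(1)])
      qed
    qed
    then show "continuous_on ?S (\<lambda>t. V t c')"
      by (rule continuous_on_eq) (simp add: V_def coord_vec_def c' map)
  qed
  define L where "L = integral {0..1} (\<lambda>t. tnorm g (\<gamma> t) (V t))"
  have "\<gamma> 0 = q" "\<gamma> 1 = q'"
    using q by (simp_all add: \<gamma>_def seg_def w_def chart_ball_def chart_inv_map[OF c])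
  \<comment> \<open>A single piece suffices: with \<open>\<tau> = real\<close> the break points are
    0 and 1.\<close>
  moreover have "curve_has_length A g \<gamma> L"
    unfolding curve_has_length_def
    by (intro exI[of _ 1] exI[of _ real] exI[of _ "\<lambda>_. V"]) (simp add: curve L_def)
  ultimately have rdist_le: "rdist A g q q' \<le> ennreal L"
    unfolding rdist_def by (intro Inf_lower) blast
  have "L \<le> integral {0..1::real} (\<lambda>t. K * norm w)"
    unfolding L_def
  proof (rule integral_le)
    show "(\<lambda>t. tnorm g (\<gamma> t) (V t)) integrable_on {0..1}"
      by (rule integrable_continuous_real[OF tnorm_curve_continuous[OF curve]])
    show "tnorm g (\<gamma> t) (V t) \<le> K * norm w" if t: "t \<in> {0..1}" for t
    proof -
      have "\<gamma> t \<in> chart_ball c z \<rho>" using dom[OF t] map[OF t] seg[OF t] by (simp add: chart_ball_def)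
      from cmp[OF this, of "V t"] show ?thesis
        using coord_vec_tangent[OF c dom[OF t], of w] coord_vec_self[OF c dom[OF t], of w]
        by (simp add: V_def)
    qed
  qed auto
  also have "\<dots> = K * dist (chart_map c q) (chart_map c q')"
    by (simp add: w_def dist_norm norm_minus_commute)
  finally have "ennreal L \<le> ennreal (K * dist (chart_map c q) (chart_map c q'))" by (rule ennreal_leI)
  with rdist_le show ?thesis by (rule order_trans)
qed

end

subsection \<open>Flow boxes with uniform constants\<close>

text \<open>Continuity of the derivative is known direction by direction only, so the operator norm
  is bounded by the sum over basis vectors, which is bounded on \<open>C\<close>; convexity permits
  the mean value inequality.\<close>

lemma Ck_on_1_lipschitz:
  fixes f :: "'a::euclidean_space \<Rightarrow> 'b::real_normed_vector"
  assumes f: "Ck_on 1 S f" and C: "compact C" "convex C" "C \<subseteq> S"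
  obtains L where "0 \<le> L" "\<And>x y. x \<in> C \<Longrightarrow> y \<in> C \<Longrightarrow> norm (f x - f y) \<le> L * norm (x - y)"
proof -
  obtain f' where f': "\<And>x. x \<in> S \<Longrightarrow> (f has_derivative f' x) (at x)"
    "\<And>v. continuous_on S (\<lambda>x. f' x v)"
    using f by auto
  have "continuous_on C (\<lambda>x. \<Sum>i\<in>Basis. norm (f' x i))"
    by (intro continuous_intros continuous_on_subset[OF f'(2) C(3)])
  then have "bounded ((\<lambda>x. \<Sum>i\<in>Basis. norm (f' x i)) ` C)"
    by (intro compact_imp_bounded compact_continuous_image C(1))
  then obtain L where L: "\<And>x. x \<in> C \<Longrightarrow> norm (\<Sum>i\<in>Basis. norm (f' x i)) \<le> L"
    by (auto simp: bounded_iff)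
  show ?thesis
  proof
    show "0 \<le> max L 0" by simp
    fix x y assume xy: "x \<in> C" "y \<in> C"
    show "norm (f x - f y) \<le> max L 0 * norm (x - y)"
    proof (rule differentiable_bound[OF C(2) _ _ xy])
      fix z assume z: "z \<in> C"
      show "(f has_derivative f' z) (at z within C)"
        using f'(1) z C(3) by (blast intro: has_derivative_at_withinI)
      have "bounded_linear (f' z)" using f'(1) z C(3) has_derivative_bounded_linear by blast
      then have "onorm (f' z) \<le> (\<Sum>i\<in>Basis. norm (f' z i))" by (rule onorm_componentwise)
      also have "\<dots> \<le> max L 0" using L[OF z] by (simp add: sum_nonneg)
      finally show "onorm (f' z) \<le> max L 0" .
    qed
  qed
qed

locale riemannian_flow = riemannian_manifold A g
  for A :: "('m::t2_space, 'e::euclidean_space) chart set" and g +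
  fixes X :: "'m \<Rightarrow> ('m, 'e) tvec" and \<phi> :: "real \<Rightarrow> 'm \<Rightarrow> 'm"
  assumes field: "C1_vector_field A X" and flow: "flow_generated_by A X \<phi>"
begin

lemma flow_zero: "\<phi> 0 x = x"
  and flow_add: "\<phi> (s + t) x = \<phi> s (\<phi> t x)"
  and flow_continuous: "continuous_on UNIV (\<lambda>(t, x). \<phi> t x)"
  using flow by (auto simp: flow_generated_by_def is_flow_def)

lemma flow_derivative:
  assumes "c \<in> A" "\<phi> t x \<in> chart_dom c"
  shows "((\<lambda>s. chart_map c (\<phi> s x)) has_vector_derivative X (\<phi> t x) c) (at t)"
  using flow[unfolded flow_generated_by_def, THEN conjunct2, rule_format, OF assms] .

lemma field_tangent: "X q \<in> tangent_space A q"
  using field[unfolded C1_vector_field_def, THEN conjunct1] by (rule spec)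

lemma field_lipschitz:
  assumes c: "c \<in> A" and ball: "cball z \<rho> \<subseteq> chart_image c"
  obtains L where "0 \<le> L" "\<And>q q'. q \<in> chart_ball c z \<rho> \<Longrightarrow> q' \<in> chart_ball c z \<rho> \<Longrightarrow>
    norm (X q c - X q' c) \<le> L * dist (chart_map c q) (chart_map c q')"
proof -
  have "Ck_on 1 (chart_image c) (\<lambda>z. X (chart_inv c z) c)"
    using field[unfolded C1_vector_field_def, THEN conjunct2] c by (rule bspec)
  then obtain L where "0 \<le> L" and L: "\<And>x y. x \<in> cball z \<rho> \<Longrightarrow> y \<in> cball z \<rho> \<Longrightarrow>
      norm (X (chart_inv c x) c - X (chart_inv c y) c) \<le> L * norm (x - y)"
    using Ck_on_1_lipschitz[OF _ compact_cball convex_cball ball] by metis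
  show ?thesis
  proof (rule that[OF \<open>0 \<le> L\<close>])
    fix q q' assume "q \<in> chart_ball c z \<rho>" "q' \<in> chart_ball c z \<rho>"
    then show "norm (X q c - X q' c) \<le> L * dist (chart_map c q) (chart_map c q')"
      using L[of "chart_map c q" "chart_map c q'"]
      by (simp add: chart_ball_def chart_inv_map[OF c] dist_norm)
  qed
qed

abbreviation speed :: "'m \<Rightarrow> real" where
  "speed q \<equiv> tnorm g q (X q)"

lemma speed_nonneg: "0 \<le> speed q"
  by (rule tnorm_nonneg[OF field_tangent])

text \<open>The chart \<open>c\<close> on \<open>S\<close> turns all data near \<open>p\<close> into Euclidean ones with the single constant
  \<open>K\<close>, which is a distortion, a Lipschitz constant, and the inverse of the admissible distances
  and of four times the admissible flow times.\<close>

definition flow_box :: "real \<Rightarrow> 'm \<Rightarrow> ('m, 'e) chart \<Rightarrow> 'm set \<Rightarrow> bool" where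
  "flow_box K p c S \<longleftrightarrow> c \<in> A \<and> S \<subseteq> chart_dom c \<and> p \<in> S \<and>
     (\<forall>q\<in>S. norm (X q c) \<le> K * speed q \<and> speed q \<le> K * norm (X q c) \<and> speed q \<le> K) \<and>
     (\<forall>q\<in>S. \<forall>q'\<in>S. norm (X q c - X q' c) \<le> K * dist (chart_map c q) (chart_map c q') \<and>
        rdist A g q q' \<le> ennreal (K * dist (chart_map c q) (chart_map c q'))) \<and>
     (\<forall>t z. \<bar>t\<bar> \<le> 1 / (4 * K) \<longrightarrow> rdist A g p z \<le> ennreal (1 / K) \<longrightarrow> \<phi> t z \<in> S) \<and>
     (\<forall>t z \<rho>. \<bar>t\<bar> \<le> 1 / (4 * K) \<longrightarrow> 0 \<le> \<rho> \<longrightarrow> \<rho> \<le> 1 / K \<longrightarrow> rdist A g (\<phi> t p) z \<le> ennreal \<rho> \<longrightarrow>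
        z \<in> S \<and> dist (chart_map c (\<phi> t p)) (chart_map c z) \<le> K * \<rho>)"

text \<open>As the constant grows, the upper bounds weaken and the admissible distances and times
  shrink. This permits passing to a maximum of finitely many constants.\<close>

lemma flow_box_mono:
  assumes box: "flow_box K p c S" and K: "1 \<le> K" "K \<le> K'"
  shows "flow_box K' p c S"
proof -
  have inv: "1 / K' \<le> 1 / K" "1 / (4 * K') \<le> 1 / (4 * K)" using K by (auto simp: field_simps)
  have up: "x \<le> K * y \<Longrightarrow> x \<le> K' * y" if "0 \<le> y" for x y :: real
    using mult_right_mono[OF K(2) that] by linarith
  have upe: "x \<le> ennreal (K * y) \<Longrightarrow> x \<le> ennreal (K' * y)" if "0 \<le> y" for x y
    using mult_right_mono[OF K(2) that] by (meson ennreal_leI order_trans)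
  have 1: "c \<in> A" "S \<subseteq> chart_dom c" "p \<in> S"
    and 2: "\<And>q. q \<in> S \<Longrightarrow> norm (X q c) \<le> K * speed q \<and> speed q \<le> K * norm (X q c) \<and> speed q \<le> K"
    and 3: "\<And>q q'. q \<in> S \<Longrightarrow> q' \<in> S \<Longrightarrow>
        norm (X q c - X q' c) \<le> K * dist (chart_map c q) (chart_map c q') \<and>
        rdist A g q q' \<le> ennreal (K * dist (chart_map c q) (chart_map c q'))"
    and 4: "\<And>t z. \<bar>t\<bar> \<le> 1 / (4 * K) \<Longrightarrow> rdist A g p z \<le> ennreal (1 / K) \<Longrightarrow> \<phi> t z \<in> S"
    and 5: "\<And>t z \<rho>. \<bar>t\<bar> \<le> 1 / (4 * K) \<Longrightarrow> 0 \<le> \<rho> \<Longrightarrow> \<rho> \<le> 1 / K \<Longrightarrow> rdist A g (\<phi> t p) z \<le> ennreal \<rho> \<Longrightarrow>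
        z \<in> S \<and> dist (chart_map c (\<phi> t p)) (chart_map c z) \<le> K * \<rho>"
    using box by (simp_all add: flow_box_def)
  show ?thesis
    unfolding flow_box_def
  proof (intro conjI ballI allI impI 1)
    fix q assume q: "q \<in> S"
    show "norm (X q c) \<le> K' * speed q" using 2[OF q] up speed_nonneg by blast
    show "speed q \<le> K' * norm (X q c)" using 2[OF q] up norm_ge_zero by blast
    show "speed q \<le> K'" using 2[OF q] K by linarith
    fix q' assume q': "q' \<in> S"
    show "norm (X q c - X q' c) \<le> K' * dist (chart_map c q) (chart_map c q')"
      using 3[OF q q'] up zero_le_dist by blast
    show "rdist A g q q' \<le> ennreal (K' * dist (chart_map c q) (chart_map c q'))"
      using 3[OF q q'] upe zero_le_dist by blast
  next
    fix t z assume "\<bar>t\<bar> \<le> 1 / (4 * K')" "rdist A g p z \<le> ennreal (1 / K')"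
    then show "\<phi> t z \<in> S" using inv by (meson 4 order_trans ennreal_leI)
  next
    fix t z \<rho> assume *: "\<bar>t\<bar> \<le> 1 / (4 * K')" "0 \<le> \<rho>" "\<rho> \<le> 1 / K'" "rdist A g (\<phi> t p) z \<le> ennreal \<rho>"
    then have **: "\<bar>t\<bar> \<le> 1 / (4 * K)" "\<rho> \<le> 1 / K" using inv by linarith+
    show "z \<in> S" using 5[OF **(1) *(2) **(2) *(4)] by blast
    show "dist (chart_map c (\<phi> t p)) (chart_map c z) \<le> K' * \<rho>"
      using 5[OF **(1) *(2) **(2) *(4)] up[OF *(2)] by blast
  qed
qed

text \<open>Nested coordinate radii: \<open>p\<close> lies within \<open>\<rho>\<close> of the
  centre; points at distance at most \<open>1 / K\<close> from \<open>p\<close> lie within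
  \<open>2 * \<rho>\<close>; flowing for short times leads from there into radius
  \<open>2 * R\<close>; a further distance \<open>1 / K\<close> from the orbit of \<open>p\<close>
  still ends in \<open>S\<close>, of radius \<open>3 * R\<close>.\<close>

lemma flow_box_near:
  obtains W K where "open W" "p\<^sub>0 \<in> W" "1 \<le> K" "\<And>p. p \<in> W \<Longrightarrow> \<exists>c S. flow_box K p c S"
proof -
  obtain c where c: "c \<in> A" "p\<^sub>0 \<in> chart_dom c" by (rule chart_around)
  define z where "z = chart_map c p\<^sub>0"
  have "z \<in> chart_image c" unfolding z_def using c(2) by (rule imageI)
  then obtain R' where "0 < R'" "cball z R' \<subseteq> chart_image c"
    using chart_open_image[OF c(1)] open_contains_cball by blast
  define R where "R = R' / 3"
  have R: "0 < R" and cball: "cball z (3 * R) \<subseteq> chart_image c"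
    using \<open>0 < R'\<close> \<open>cball z R' \<subseteq> _\<close> by (auto simp: R_def)
  then have ball: "ball z (3 * R) \<subseteq> chart_image c" using ball_subset_cball by blast
  define S where "S = chart_ball c z (3 * R)"
  obtain K\<^sub>0 where K\<^sub>0: "1 \<le> K\<^sub>0" and cmp: "\<And>q v. q \<in> chart_dom c \<Longrightarrow> chart_map c q \<in> cball z (3 * R) \<Longrightarrow>
      v \<in> tangent_space A q \<Longrightarrow> norm (v c) \<le> K\<^sub>0 * tnorm g q v \<and> tnorm g q v \<le> K\<^sub>0 * norm (v c)"
    using metric_comparison[OF c(1) compact_cball cball] by metis
  have cmpS: "norm (v c) \<le> K\<^sub>0 * tnorm g q v" "tnorm g q v \<le> K\<^sub>0 * norm (v c)"
    if "q \<in> chart_ball c z \<rho>" "\<rho> \<le> 3 * R" "v \<in> tangent_space A q" for q v \<rho>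
    using cmp[of q v] that by (auto simp: chart_ball_def)
  obtain L where L: "0 \<le> L" "\<And>q q'. q \<in> S \<Longrightarrow> q' \<in> S \<Longrightarrow>
      norm (X q c - X q' c) \<le> L * dist (chart_map c q) (chart_map c q')"
    using field_lipschitz[OF c(1) cball] unfolding S_def by metis
  have p0S: "p\<^sub>0 \<in> S" using c(2) R by (simp add: S_def chart_ball_def z_def)
  \<comment> \<open>Bounds the coordinates of \<open>X\<close> on \<open>S\<close> by their value at
    the centre plus the Lipschitz variation.\<close>
  define B where "B = norm (X p\<^sub>0 c) + L * (3 * R)"
  have B: "speed q \<le> K\<^sub>0 * B" if q: "q \<in> S" for q
  proof -
    have "dist (chart_map c q) (chart_map c p\<^sub>0) \<le> 3 * R"
      using q by (simp add: S_def chart_ball_def z_def dist_commute)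
    then have "norm (X q c) \<le> B"
      using L(2)[OF q p0S] mult_left_mono[OF _ L(1)] norm_triangle_ineq2[of "X q c" "X p\<^sub>0 c"]
      unfolding B_def by fastforce
    then show ?thesis
      using cmpS(2)[OF q[unfolded S_def] _ field_tangent] K\<^sub>0 by (smt (verit) mult_left_mono)
  qed
  obtain T W\<^sub>0 where T: "0 < T" and W\<^sub>0: "open W\<^sub>0" "p\<^sub>0 \<in> W\<^sub>0"
    and stay: "\<And>t q. \<bar>t\<bar> < T \<Longrightarrow> q \<in> W\<^sub>0 \<Longrightarrow> \<phi> t q \<in> chart_ball c z (2 * R)"
  proof -
    have "open ((\<lambda>(t, x). \<phi> t x) -` chart_ball c z (2 * R))"
      by (rule open_vimage[OF open_chart_ball[OF c(1)] flow_continuous])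
    moreover have "(0, p\<^sub>0) \<in> (\<lambda>(t, x). \<phi> t x) -` chart_ball c z (2 * R)"
      using c(2) R by (simp add: flow_zero chart_ball_def z_def)
    ultimately obtain I W where IW: "open I" "open W" "(0, p\<^sub>0) \<in> I \<times> W"
      "I \<times> W \<subseteq> (\<lambda>(t, x). \<phi> t x) -` chart_ball c z (2 * R)"
      by (rule open_prod_elim)
    then obtain T where "0 < T" "ball 0 T \<subseteq> I" using open_contains_ball by blast
    with IW that show ?thesis by (fastforce simp: subset_iff)
  qed
  obtain \<rho> where \<rho>: "0 < \<rho>" "\<rho> \<le> R" and sub: "chart_ball c z (2 * \<rho>) \<subseteq> W\<^sub>0"
  proof -
    have "z \<in> chart_map c ` (chart_dom c \<inter> W\<^sub>0)" unfolding z_def using c(2) W\<^sub>0(2) by blast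
    then obtain e where e: "0 < e" "ball z e \<subseteq> chart_map c ` (chart_dom c \<inter> W\<^sub>0)"
      using open_map_chart[OF c(1) W\<^sub>0(1)] open_contains_ball by blast
    show ?thesis
    proof (rule that)
      show "0 < min R (e / 2)" "min R (e / 2) \<le> R" using R e(1) by auto
      show "chart_ball c z (2 * min R (e / 2)) \<subseteq> W\<^sub>0"
      proof
        fix q assume q: "q \<in> chart_ball c z (2 * min R (e / 2))"
        then have "chart_map c q \<in> chart_map c ` (chart_dom c \<inter> W\<^sub>0)"
          using e(2) by (auto simp: chart_ball_def)
        then obtain p where p: "chart_map c q = chart_map c p" "p \<in> chart_dom c \<inter> W\<^sub>0" by (rule imageE)
        have "q = p" using inj_onD[OF chart_inj[OF c(1)] p(1)] p(2) q by (simp add: chart_ball_def)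
        then show "q \<in> W\<^sub>0" using p(2) by simp
      qed
    qed
  qed
  \<comment> \<open>In order: metric distortion, bound on the speed, Lipschitz constant of
    \<open>X\<close>, a term making a distance \<open>1 / K\<close> cost at most
    \<open>\<rho> / 2\<close> in coordinates, and a term making \<open>1 / (4 * K)\<close> less than
    \<open>T\<close>.\<close>
  define K where "K = max K\<^sub>0 (max (K\<^sub>0 * B) (max L (max (2 * K\<^sub>0 / \<rho>) (1 / T))))"
  have K: "1 \<le> K" "K\<^sub>0 \<le> K" "K\<^sub>0 * B \<le> K" "L \<le> K" "2 * K\<^sub>0 / \<rho> \<le> K" "1 / T \<le> K"
    using K\<^sub>0 by (auto simp: K_def)
  have r: "K\<^sub>0 * (1 / K) \<le> \<rho> / 2" using K(1,5) \<rho>(1) by (simp add: field_simps)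
  have time: "1 / (4 * K) < T" using K(1,6) T by (simp add: field_simps)
  have up: "x \<le> K\<^sub>0 * y \<Longrightarrow> x \<le> K * y" if "0 \<le> y" for x y :: real
    using mult_right_mono[OF K(2) that] by linarith
  have box: "flow_box K p c S" if p: "p \<in> chart_ball c z \<rho>" for p
    unfolding flow_box_def
  proof (intro conjI ballI allI impI)
    show "c \<in> A" by (rule c(1))
    show "S \<subseteq> chart_dom c" by (auto simp: S_def chart_ball_def)
    show "p \<in> S" using p \<rho> R by (auto simp: S_def chart_ball_def)
    fix q assume q: "q \<in> S"
    note q' = q[unfolded S_def]
    show "norm (X q c) \<le> K * speed q"
      using cmpS(1)[OF q' _ field_tangent] by (intro up speed_nonneg) simp
    show "speed q \<le> K * norm (X q c)"
      using cmpS(2)[OF q' _ field_tangent] by (intro up norm_ge_zero) simp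
    show "speed q \<le> K" using B[OF q] K(3) by linarith
    fix q2 assume q2: "q2 \<in> S"
    show "norm (X q c - X q2 c) \<le> K * dist (chart_map c q) (chart_map c q2)"
      using L(2)[OF q q2] mult_right_mono[OF K(4) zero_le_dist] by (rule order_trans)
    have "rdist A g q q2 \<le> ennreal (K\<^sub>0 * dist (chart_map c q) (chart_map c q2))"
      by (rule rdist_upper[OF c(1) ball _ q' q2[unfolded S_def]]) (rule cmpS(2)[OF _ order_refl])
    also have "\<dots> \<le> ennreal (K * dist (chart_map c q) (chart_map c q2))"
      by (intro ennreal_leI mult_right_mono K(2)) simp
    finally show "rdist A g q q2 \<le> ennreal (K * dist (chart_map c q) (chart_map c q2))" .
  next
    fix t z' assume t: "\<bar>t\<bar> \<le> 1 / (4 * K)" and z': "rdist A g p z' \<le> ennreal (1 / K)"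
    have "z' \<in> chart_ball c z (2 * \<rho>)"
    proof (rule rdist_lower(1)[OF c(1) _ _ _ _ _ _ z'])
      show "ball z (2 * \<rho>) \<subseteq> chart_image c" using ball \<rho> subset_ball[of "2 * \<rho>" "3 * R" z] by auto
      show "norm (v c) \<le> K\<^sub>0 * tnorm g q v"
        if "q \<in> chart_ball c z (2 * \<rho>)" "v \<in> tangent_space A q" for q v
        using cmpS(1)[OF that(1) _ that(2)] \<rho> by simp
      show "p \<in> chart_dom c" using p by (simp add: chart_ball_def)
      show "dist z (chart_map c p) + K\<^sub>0 * (1 / K) < 2 * \<rho>"
      proof -
        have "dist z (chart_map c p) < \<rho>" using p by (simp add: chart_ball_def)
        then show ?thesis using r \<rho>(1) by linarith
      qed
    qed (use K\<^sub>0 K(1) in auto)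
    then have "\<phi> t z' \<in> chart_ball c z (2 * R)" using stay[of t z'] sub t time by auto
    then show "\<phi> t z' \<in> S" using R by (auto simp: S_def chart_ball_def)
  next
    fix t z' \<sigma> assume t: "\<bar>t\<bar> \<le> 1 / (4 * K)" and \<sigma>: "0 \<le> \<sigma>" "\<sigma> \<le> 1 / K"
      and z': "rdist A g (\<phi> t p) z' \<le> ennreal \<sigma>"
    have "p \<in> W\<^sub>0" using p sub \<rho>(1) by (auto simp: chart_ball_def)
    then have tp: "\<phi> t p \<in> chart_ball c z (2 * R)" using stay[of t p] t time by auto
    have "K\<^sub>0 * \<sigma> \<le> \<rho> / 2" using r mult_left_mono[OF \<sigma>(2), of K\<^sub>0] K\<^sub>0 by linarith
    then have len: "dist z (chart_map c (\<phi> t p)) + K\<^sub>0 * \<sigma> < 3 * R"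
      using tp \<rho> by (simp add: chart_ball_def)
    have dom: "\<phi> t p \<in> chart_dom c" using tp by (simp add: chart_ball_def)
    have K0: "0 \<le> K\<^sub>0" using K\<^sub>0 by simp
    note low = rdist_lower[OF c(1) ball cmpS(1)[OF _ order_refl] K0 dom len \<sigma>(1) z']
    show "z' \<in> S" unfolding S_def by (rule low(1))
    show "dist (chart_map c (\<phi> t p)) (chart_map c z') \<le> K * \<sigma>" by (rule up[OF \<sigma>(1) low(2)])
  qed
  show ?thesis
  proof (rule that[OF open_chart_ball[OF c(1)] _ K(1)])
    show "p\<^sub>0 \<in> chart_ball c z \<rho>" using c(2) \<rho>(1) by (simp add: chart_ball_def z_def)
    show "\<exists>c S. flow_box K p c S" if "p \<in> chart_ball c z \<rho>" for p
      by (intro exI, rule box[OF that])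
  qed
qed

text \<open>A finite subcover by the neighbourhoods from \<open>flow_box_near\<close> leaves
  finitely many constants, and their maximum serves at every point.\<close>

lemma uniform_flow_box:
  assumes "compact (UNIV :: 'm set)"
  obtains K where "1 \<le> K" "\<And>p. \<exists>c S. flow_box K p c S"
proof -
  have "\<exists>W K. open W \<and> p \<in> W \<and> 1 \<le> K \<and> (\<forall>q\<in>W. \<exists>c S. flow_box K q c S)" for p
    by (rule flow_box_near[of p]) blast
  then obtain W K where W: "\<And>p. open (W p)" "\<And>p. p \<in> W p" and K: "\<And>p. 1 \<le> K p"
    and box: "\<And>p q. q \<in> W p \<Longrightarrow> \<exists>c S. flow_box (K p) q c S"
    by metis
  obtain F where F: "finite F" "UNIV \<subseteq> (\<Union>p\<in>F. W p)"
  proof (rule compactE_image[OF assms, of UNIV W])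
    show "open (W p)" for p by (rule W(1))
    show "UNIV \<subseteq> (\<Union>p\<in>UNIV. W p)" using W(2) by blast
  qed
  have "F \<noteq> {}" using F(2) by auto
  define K' where "K' = Max (K ` F)"
  have le: "K p \<le> K'" if "p \<in> F" for p using F(1) that by (simp add: K'_def)
  show ?thesis
  proof (rule that)
    show "1 \<le> K'" using \<open>F \<noteq> {}\<close> le K by (metis all_not_in_conv order_trans)
    fix q
    obtain p where p: "p \<in> F" "q \<in> W p" using F(2) by auto
    show "\<exists>c S. flow_box K' q c S" using box[OF p(2)] flow_box_mono[OF _ K le[OF p(1)]] by blast
  qed
qed

end

subsection \<open>Shadowing orbits\<close>

locale boxed_flow = riemannian_flow A g X \<phi>
  for A :: "('m::t2_space, 'e::euclidean_space) chart set" and g X \<phi> +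
  fixes K :: real
  assumes K: "1 \<le> K" and box: "\<And>p. \<exists>c S. flow_box K p c S"
begin

lemma rdist_refl: "rdist A g p p = 0"
proof -
  obtain c S where "flow_box K p c S" using box by blast
  then have "rdist A g p p \<le> ennreal (K * dist (chart_map c p) (chart_map c p))"
    unfolding flow_box_def by blast
  then show ?thesis by simp
qed

text \<open>Comes from the last clause of \<open>flow_box\<close> at time and radius 0. It serves at
  zeros of the field, where the tolerance for shadowing is 0.\<close>

lemma rdist_zero_imp_eq:
  assumes "rdist A g p q = 0"
  shows "p = q"
proof -
  obtain c S where b: "flow_box K p c S" using box by blast
  have "rdist A g (\<phi> 0 p) q \<le> ennreal 0" using assms by (simp add: flow_zero)
  then have q: "q \<in> S" "dist (chart_map c (\<phi> 0 p)) (chart_map c q) \<le> K * 0"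
    using b[unfolded flow_box_def, THEN conjunct2, THEN conjunct2, THEN conjunct2, THEN conjunct2,
        THEN conjunct2, THEN conjunct2, rule_format, of 0 0 q] K by simp_all
  have c: "c \<in> A" "p \<in> chart_dom c" "q \<in> chart_dom c" using b q(1) by (auto simp: flow_box_def)
  have "chart_map c p = chart_map c q" using q(2) by (simp add: flow_zero)
  then show ?thesis by (rule inj_onD[OF chart_inj[OF c(1)] _ c(2,3)])
qed

lemma speed_le: "speed p \<le> K"
  using box[of p] unfolding flow_box_def by blast

context
  fixes p c S
  assumes pcS: "flow_box K p c S"
begin

lemma box_chart: "c \<in> A" "S \<subseteq> chart_dom c" "p \<in> S"
  using pcS by (simp_all add: flow_box_def)

lemma box_speed: "q \<in> S \<Longrightarrow> norm (X q c) \<le> K * speed q" "q \<in> S \<Longrightarrow> speed q \<le> K * norm (X q c)"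
  using pcS by (simp_all add: flow_box_def)

lemma box_lipschitz:
  "q \<in> S \<Longrightarrow> q' \<in> S \<Longrightarrow> norm (X q c - X q' c) \<le> K * dist (chart_map c q) (chart_map c q')"
  using pcS by (simp add: flow_box_def)

lemma box_rdist_le:
  "q \<in> S \<Longrightarrow> q' \<in> S \<Longrightarrow> rdist A g q q' \<le> ennreal (K * dist (chart_map c q) (chart_map c q'))"
  using pcS by (simp add: flow_box_def)

lemma box_stays: "\<bar>t\<bar> \<le> 1 / (4 * K) \<Longrightarrow> rdist A g p z \<le> ennreal (1 / K) \<Longrightarrow> \<phi> t z \<in> S"
  using pcS by (simp add: flow_box_def)

lemma box_dist_le:
  assumes "\<bar>t\<bar> \<le> 1 / (4 * K)" "0 \<le> \<rho>" "\<rho> \<le> 1 / K" "rdist A g (\<phi> t p) z \<le> ennreal \<rho>"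
  shows "z \<in> S" "dist (chart_map c (\<phi> t p)) (chart_map c z) \<le> K * \<rho>"
  using pcS assms by (simp_all add: flow_box_def)

text \<open>\<open>short_time_affine\<close> with Lipschitz constant \<open>K\<close>; its condition
  \<open>4 * \<tau> * L \<le> 1\<close> is the reason for the time scale
  \<open>1 / (4 * K)\<close>.\<close>

lemma box_affine:
  assumes z: "rdist A g p z \<le> ennreal (1 / K)"
  shows "\<bar>t\<bar> \<le> 1 / (4 * K) \<Longrightarrow> norm (X (\<phi> t z) c - X z c) \<le> norm (X z c) / 2"
    and "\<bar>a\<bar> \<le> 1 / (4 * K) \<Longrightarrow> \<bar>b\<bar> \<le> 1 / (4 * K) \<Longrightarrow>
      norm (chart_map c (\<phi> a z) - chart_map c (\<phi> b z) - (a - b) *\<^sub>R X z c) \<le> \<bar>a - b\<bar> * norm (X z c) / 2"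
proof -
  let ?e = "\<lambda>t. chart_map c (\<phi> t z)" and ?v = "\<lambda>t. X (\<phi> t z) c"
  have in_S: "\<phi> t z \<in> S" if "\<bar>t\<bar> \<le> 1 / (4 * K)" for t
    by (rule box_stays[OF that z])
  have 0: "\<bar>0\<bar> \<le> 1 / (4 * K)" using K by simp
  have deriv: "(?e has_vector_derivative ?v t) (at t)" if "\<bar>t\<bar> \<le> 1 / (4 * K)" for t
    using flow_derivative[OF box_chart(1)] in_S[OF that] box_chart(2) by blast
  have lip: "norm (?v t - ?v 0) \<le> K * norm (?e t - ?e 0)" if "\<bar>t\<bar> \<le> 1 / (4 * K)" for t
    using box_lipschitz[OF in_S[OF that] in_S[OF 0]] by (simp add: dist_norm)
  have K': "0 \<le> K" "4 * (1 / (4 * K)) * K \<le> 1" using K by auto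
  show "norm (X (\<phi> t z) c - X z c) \<le> norm (X z c) / 2" if "\<bar>t\<bar> \<le> 1 / (4 * K)"
    using short_time_affine(1)[of "1 / (4 * K)" ?e ?v, OF deriv lip K' that] by (simp add: flow_zero)
  show "norm (?e a - ?e b - (a - b) *\<^sub>R X z c) \<le> \<bar>a - b\<bar> * norm (X z c) / 2"
    if "\<bar>a\<bar> \<le> 1 / (4 * K)" "\<bar>b\<bar> \<le> 1 / (4 * K)"
    using short_time_affine(2)[of "1 / (4 * K)" ?e ?v, OF deriv lip K' that] by (simp add: flow_zero)
qed

text \<open>\<open>short_time_bound\<close> for the coordinate difference of two orbits, which
  satisfies a linear differential inequality with no additive term.\<close>

lemma box_diverge:
  assumes z: "rdist A g p z \<le> ennreal (1 / K)" and t: "\<bar>t\<bar> \<le> 1 / (4 * K)"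
  shows "dist (chart_map c (\<phi> t p)) (chart_map c (\<phi> t z)) \<le> 2 * dist (chart_map c p) (chart_map c z)"
proof -
  let ?D = "\<lambda>t. chart_map c (\<phi> t p) - chart_map c (\<phi> t z)" and ?D' = "\<lambda>t. X (\<phi> t p) c - X (\<phi> t z) c"
  have in_S: "\<phi> t p \<in> S" "\<phi> t z \<in> S" if "\<bar>t\<bar> \<le> 1 / (4 * K)" for t
    using box_stays[OF that z] box_stays[OF that, of p] by (simp_all add: rdist_refl)
  have "norm (?D t) \<le> 2 * (norm (?D 0) + 1 / (4 * K) * 0)"
  proof (rule short_time_bound[where D' = ?D' and L = K])
    fix t assume t: "\<bar>t\<bar> \<le> 1 / (4 * K)"
    show "(?D has_vector_derivative ?D' t) (at t)"
      using in_S[OF t] box_chart by (intro has_vector_derivative_diff flow_derivative) auto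
    show "norm (?D' t) \<le> K * norm (?D t) + 0"
      using box_lipschitz[OF in_S[OF t]] by (simp add: dist_norm)
  qed (use K t in auto)
  then show ?thesis by (simp add: flow_zero dist_norm)
qed

end

text \<open>For short times the displacement bound of \<open>box_affine\<close> is a multiple of
  \<open>norm (X p c)\<close>, hence 0; an arbitrary time is split into \<open>n\<close> short
  steps.\<close>

lemma zero_speed_fixed:
  assumes "speed p = 0"
  shows "\<phi> t p = p"
proof -
  obtain c S where b: "flow_box K p c S" using box by blast
  have pp: "rdist A g p p \<le> ennreal (1 / K)" by (simp add: rdist_refl)
  have X0: "X p c = 0" using box_speed(1)[OF b box_chart(3)[OF b]] assms by simp
  have short: "\<phi> s p = p" if "\<bar>s\<bar> \<le> 1 / (4 * K)" for s
  proof -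
    have "chart_map c (\<phi> s p) = chart_map c p"
      using box_affine(2)[OF b pp that, of 0] K by (simp add: X0 flow_zero)
    then show ?thesis
      by (rule inj_onD[OF chart_inj[OF box_chart(1)[OF b]]])
        (use box_chart(2,3)[OF b] box_stays[OF b that pp] in auto)
  qed
  obtain n :: nat where n: "4 * K * \<bar>t\<bar> < n" using reals_Archimedean2 by blast
  then have n0: "0 < real n" using K by (smt (verit) mult_nonneg_nonneg abs_ge_zero)
  have "\<bar>t / n\<bar> \<le> 1 / (4 * K)" using n n0 K by (simp add: field_simps)
  then have step: "\<phi> (t / n) p = p" by (rule short)
  have "\<phi> (real k * (t / n)) p = p" for k
    by (induction k) (simp_all add: flow_zero algebra_simps flow_add step add_divide_distrib)
  from this[of n] show ?thesis using n0 by simp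
qed

lemma speed_orbit_pos:
  assumes "speed x \<noteq> 0"
  shows "0 < speed (\<phi> s x)"
proof (rule ccontr)
  assume "\<not> 0 < speed (\<phi> s x)"
  then have "speed (\<phi> s x) = 0" using speed_nonneg[of "\<phi> s x"] by linarith
  then have "\<phi> (- s) (\<phi> s x) = \<phi> s x" by (rule zero_speed_fixed)
  then have "x = \<phi> s x" by (simp flip: flow_add add: flow_zero)
  then show False using assms \<open>speed (\<phi> s x) = 0\<close> by simp
qed

section \<open>Shadowing under a reparametrization\<close>

definition shadows :: "real \<Rightarrow> (real \<Rightarrow> real) \<Rightarrow> 'm \<Rightarrow> 'm \<Rightarrow> bool" where
  "shadows \<delta> h x y \<longleftrightarrow> (\<forall>s. rdist A g (\<phi> s x) (\<phi> (h s) y) \<le> ennreal (\<delta> * speed (\<phi> s x)))"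

text \<open>The factor 112 is \<open>4 * 28\<close>: the time corrections of size
  \<open>28 * K\<^sup>2 * \<delta>\<close> made by the averaging must be admissible flow times. The
  first bound keeps shadowing points within the reach of a flow box.\<close>

lemma small_delta:
  assumes "0 < \<delta>" "112 * K ^ 3 * \<delta> \<le> 1"
  shows "\<delta> * speed p \<le> 1 / K" "K ^ 3 * \<delta> \<le> 1 / 112" "28 * K\<^sup>2 * \<delta> \<le> 1 / (4 * K)"
proof -
  show 3: "K ^ 3 * \<delta> \<le> 1 / 112" using assms by simp
  have "K\<^sup>2 * \<delta> \<le> K ^ 3 * \<delta>"
    using K assms(1) by (intro mult_right_mono power_increasing) auto
  then have "K * (K * \<delta>) \<le> 1" using 3 by (simp add: power2_eq_square mult.assoc)
  then have "\<delta> * K \<le> 1 / K" using K by (simp add: field_simps)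
  then show "\<delta> * speed p \<le> 1 / K"
    using mult_left_mono[OF speed_le[of p], of \<delta>] assms(1) by linarith
  show "28 * K\<^sup>2 * \<delta> \<le> 1 / (4 * K)"
    using assms(2) K by (simp add: field_simps power2_eq_square power3_eq_cube)
qed

text \<open>This is where rescaling by the speed pays off: the distance is a small multiple of
  \<open>norm (X p c)\<close>, so the Lipschitz bound changes \<open>X\<close> by a small proportion
  only, however close \<open>p\<close> is to a zero.\<close>

lemma shadow_chart:
  assumes b: "flow_box K p c S" and \<delta>: "0 < \<delta>" "112 * K ^ 3 * \<delta> \<le> 1"
    and q: "rdist A g p q \<le> ennreal (\<delta> * speed p)"
  shows "rdist A g p q \<le> ennreal (1 / K)" "q \<in> S"
    and "dist (chart_map c p) (chart_map c q) \<le> K\<^sup>2 * \<delta> * norm (X p c)"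
    and "norm (X p c) / 2 \<le> norm (X q c)" "norm (X q c) \<le> 3 / 2 * norm (X p c)"
proof -
  show near: "rdist A g p q \<le> ennreal (1 / K)"
    using q ennreal_leI[OF small_delta(1)[OF \<delta>]] by (rule order_trans)
  have 0: "\<bar>0\<bar> \<le> 1 / (4 * K)" "0 \<le> \<delta> * speed p" "rdist A g (\<phi> 0 p) q \<le> ennreal (\<delta> * speed p)"
    using K \<delta> q speed_nonneg by (simp_all add: flow_zero)
  note d = box_dist_le[OF b 0(1,2) small_delta(1)[OF \<delta>] 0(3), unfolded flow_zero]
  show qS: "q \<in> S" by (rule d(1))
  have "K * (\<delta> * speed p) \<le> K * (\<delta> * (K * norm (X p c)))"
    using K \<delta> box_speed(2)[OF b box_chart(3)[OF b]] by (intro mult_left_mono) auto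
  with d(2) show dd: "dist (chart_map c p) (chart_map c q) \<le> K\<^sup>2 * \<delta> * norm (X p c)"
    by (simp add: power2_eq_square mult_ac)
  have "norm (X p c - X q c) \<le> K * dist (chart_map c p) (chart_map c q)"
    by (rule box_lipschitz[OF b box_chart(3)[OF b] qS])
  also have "\<dots> \<le> K * (K\<^sup>2 * \<delta> * norm (X p c))" using K dd by (intro mult_left_mono) auto
  also have "\<dots> = (K ^ 3 * \<delta>) * norm (X p c)" by (simp add: power2_eq_square power3_eq_cube)
  also have "\<dots> \<le> 1 / 112 * norm (X p c)"
    using small_delta(2)[OF \<delta>] by (intro mult_right_mono) auto
  finally have "norm (X p c - X q c) \<le> norm (X p c) / 2" using norm_ge_zero[of "X p c"] by linarith
  then show "norm (X p c) / 2 \<le> norm (X q c)" "norm (X q c) \<le> 3 / 2 * norm (X p c)"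
    using norm_triangle_ineq2[of "X p c" "X q c"] norm_triangle_ineq2[of "X q c" "X p c"]
    by (simp_all add: norm_minus_commute)
qed

text \<open>By continuity, \<open>h (s + u) - h s - u\<close> cannot leave a neighbourhood of \<open>0\<close> as long as it is
  forced to be either small or large.\<close>

lemma shadow_drift:
  assumes h: "h \<in> C00" and sh: "shadows \<delta> h x y" and x: "speed x \<noteq> 0"
    and \<delta>: "0 < \<delta>" "112 * K ^ 3 * \<delta> < 1" and u: "0 \<le> u" "u \<le> 1 / (8 * K)"
  shows "\<bar>h (s + u) - h s - u\<bar> \<le> 14 * K\<^sup>2 * \<delta>"
proof -
  define \<tau> where "\<tau> = 1 / (4 * K)"
  define p where "p = \<phi> s x"
  define q where "q = \<phi> (h s) y"
  define k where "k v = h (s + v) - h s" for v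
  obtain c S where b: "flow_box K p c S" using box by blast
  let ?\<kappa> = "chart_map c"
  define F where "F = norm (X p c)"
  have \<delta>': "112 * K ^ 3 * \<delta> \<le> 1" using \<delta>(2) by simp
  have pq: "rdist A g p q \<le> ennreal (\<delta> * speed p)"
    using sh unfolding shadows_def p_def q_def by blast
  note near = shadow_chart[OF b \<delta>(1) \<delta>' pq, folded F_def]
  have F: "0 < F"
  proof -
    have "0 < K * F" using box_speed(2)[OF b box_chart(3)[OF b]] speed_orbit_pos[OF x, of s]
      by (simp add: F_def p_def)
    then show ?thesis using K by (simp add: zero_less_mult_iff)
  qed
  have pp: "rdist A g p p \<le> ennreal (1 / K)" by (simp add: rdist_refl)
  \<comment> \<open>The strict gap between small and large: below \<open>\<tau> / 2\<close> the
    deviation is forced under \<open>14 * K\<^sup>2 * \<delta>\<close>, so the value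
    \<open>\<tau> / 2\<close> itself is never taken.\<close>
  have \<eta>: "14 * K\<^sup>2 * \<delta> < \<tau> / 2"
    using \<delta>(2) K by (simp add: \<tau>_def field_simps power2_eq_square power3_eq_cube)
  have close: "\<bar>k v - v\<bar> \<le> 14 * K\<^sup>2 * \<delta>" if v: "0 \<le> v" "v \<le> \<tau> / 2" and kv: "\<bar>k v - v\<bar> \<le> \<tau> / 2" for v
  proof -
    have v\<tau>: "\<bar>v\<bar> \<le> 1 / (4 * K)" "\<bar>k v\<bar> \<le> 1 / (4 * K)" using v kv by (auto simp: \<tau>_def)
    have vp: "\<phi> v p \<in> S" by (rule box_stays[OF b v\<tau>(1) pp])
    have "norm (X (\<phi> v p) c) \<le> 3 / 2 * F"
      using box_affine(1)[OF b pp v\<tau>(1)] norm_triangle_ineq2[of "X (\<phi> v p) c" "X p c"]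
      by (simp add: F_def)
    moreover have "speed (\<phi> v p) \<le> K * norm (X (\<phi> v p) c)" by (rule box_speed(2)[OF b vp])
    ultimately have sp: "speed (\<phi> v p) \<le> K * (3 / 2 * F)"
      using K by (smt (verit) mult_left_mono)
    have "rdist A g (\<phi> v p) (\<phi> (k v) q) \<le> ennreal (\<delta> * speed (\<phi> v p))"
      using sh[unfolded shadows_def, rule_format, of "s + v"]
      by (simp add: p_def q_def k_def add.commute flip: flow_add)
    then have "dist (?\<kappa> (\<phi> v p)) (?\<kappa> (\<phi> (k v) q)) \<le> K * (\<delta> * speed (\<phi> v p))"
      using \<delta>(1) speed_nonneg by (intro box_dist_le(2)[OF b v\<tau>(1) _ small_delta(1)[OF \<delta>(1) \<delta>']]) auto
    also have "\<dots> \<le> K * (\<delta> * (K * (3 / 2 * F)))"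
      using sp K \<delta>(1) by (intro mult_left_mono) auto
    also have "\<dots> = 3 / 2 * (K\<^sup>2 * \<delta> * F)" by (simp add: power2_eq_square)
    finally have d1: "dist (?\<kappa> (\<phi> v p)) (?\<kappa> (\<phi> (k v) q)) \<le> 3 / 2 * (K\<^sup>2 * \<delta> * F)" .
    have d2: "dist (?\<kappa> (\<phi> v p)) (?\<kappa> (\<phi> v q)) \<le> 2 * (K\<^sup>2 * \<delta> * F)"
      using box_diverge[OF b near(1) v\<tau>(1)] near(3) by linarith
    \<comment> \<open>Shadowing at time \<open>s + v\<close> gives the share \<open>3/2\<close>, the
      spreading of the two orbits over time \<open>v\<close> the share \<open>2\<close>. Since
      \<open>q\<close> travels with speed at least \<open>F / 2\<close> up to a relative error of
      one half, the time lag is at most \<open>4 * 7/2 = 14\<close> units.\<close>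
    have d3: "norm (?\<kappa> (\<phi> (k v) q) - ?\<kappa> (\<phi> v q)) \<le> 7 / 2 * (K\<^sup>2 * \<delta> * F)"
      using d1 d2 dist_triangle[of "?\<kappa> (\<phi> (k v) q)" "?\<kappa> (\<phi> v q)" "?\<kappa> (\<phi> v p)"]
      by (simp add: dist_norm norm_minus_commute)
    have "norm ((k v - v) *\<^sub>R X q c) - norm (?\<kappa> (\<phi> (k v) q) - ?\<kappa> (\<phi> v q)) \<le> \<bar>k v - v\<bar> * norm (X q c) / 2"
      using box_affine(2)[OF b near(1) v\<tau>(2,1)]
        norm_triangle_ineq2[of "(k v - v) *\<^sub>R X q c" "?\<kappa> (\<phi> (k v) q) - ?\<kappa> (\<phi> v q)"]
        norm_minus_commute[of "(k v - v) *\<^sub>R X q c" "?\<kappa> (\<phi> (k v) q) - ?\<kappa> (\<phi> v q)"]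
      by linarith
    then have "\<bar>k v - v\<bar> * norm (X q c) / 2 \<le> 7 / 2 * (K\<^sup>2 * \<delta> * F)"
      using d3 unfolding norm_scaleR by linarith
    moreover have "\<bar>k v - v\<bar> * (F / 2) \<le> \<bar>k v - v\<bar> * norm (X q c)"
      using near(4) by (intro mult_left_mono) auto
    ultimately have "\<bar>k v - v\<bar> * F \<le> (14 * K\<^sup>2 * \<delta>) * F" by simp
    then show ?thesis using F by simp
  qed
  have cont: "continuous_on {0..u} (\<lambda>v. \<bar>k v - v\<bar>)"
  proof -
    have hc: "continuous_on UNIV h" using h by (simp add: C00_def)
    show ?thesis unfolding k_def
      by (intro continuous_intros continuous_on_compose2[OF hc]) auto
  qed
  have "u \<le> \<tau> / 2" using u by (simp add: \<tau>_def)
  have "\<bar>k u - u\<bar> \<le> \<tau> / 2"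
  proof (rule ccontr)
    assume "\<not> \<bar>k u - u\<bar> \<le> \<tau> / 2"
    moreover have "\<bar>k 0 - 0\<bar> \<le> \<tau> / 2" using K by (simp add: k_def \<tau>_def)
    ultimately obtain v where "0 \<le> v" "v \<le> u" "\<bar>k v - v\<bar> = \<tau> / 2"
      using IVT'[of "\<lambda>v. \<bar>k v - v\<bar>" 0 "\<tau> / 2" u] u(1) cont by auto
    with close[of v] \<eta> \<open>u \<le> \<tau> / 2\<close> show False by simp
  qed
  then show ?thesis using close[of u] u \<open>u \<le> \<tau> / 2\<close> by (simp add: k_def)
qed

text \<open>Averaging over windows of length \<open>1 / (8 * K)\<close> turns the drift
  \<open>14 * K\<^sup>2 * \<delta>\<close> into a slope error \<open>112 * K ^ 3 * \<delta>\<close>;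
  requiring at most \<open>1/5\<close> gives the constant 560.\<close>

lemma shadow_smoothing:
  assumes h: "h \<in> C00" and sh: "shadows \<delta> h x y" and x: "speed x \<noteq> 0"
    and \<delta>: "0 < \<delta>" "560 * K ^ 3 * \<delta> \<le> 1"
  obtains k where "k \<in> Rep_alpha (1/5)" "\<And>s. \<bar>k s - h s\<bar> \<le> 28 * K\<^sup>2 * \<delta>"
proof -
  have T: "0 < 1 / (8 * K)" using K by simp
  have "0 < K ^ 3 * \<delta>" using K \<delta>(1) by simp
  then have "112 * K ^ 3 * \<delta> < 1" using \<delta>(2) by linarith
  then obtain k where k: "k \<in> Rep_alpha (14 * K\<^sup>2 * \<delta> / (1 / (8 * K)))" "\<And>s. \<bar>k s - h s\<bar> \<le> 2 * (14 * K\<^sup>2 * \<delta>)"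
    using sliding_average[OF h T shadow_drift[OF h sh x \<delta>(1)]] by blast
  have "14 * K\<^sup>2 * \<delta> / (1 / (8 * K)) \<le> 1/5"
    using \<delta>(2) by (simp add: power2_eq_square power3_eq_cube mult_ac)
  then have "k \<in> Rep_alpha (1/5)" using k(1) unfolding Rep_alpha_def by fastforce
  moreover have "\<bar>k s - h s\<bar> \<le> 28 * K\<^sup>2 * \<delta>" for s using k(2)[of s] by simp
  ultimately show ?thesis by (rule that)
qed

text \<open>Here \<open>a\<close> and \<open>b'\<close> are the time corrections between the given
  reparametrizations and their averages. Each moves its point by at most
  \<open>63 = 3/2 * 28 * 3/2\<close> units of \<open>K\<^sup>2 * \<delta> * F\<close>, and
  \<open>q\<close>, \<open>r\<close> are 2 units apart, giving 128.\<close>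

lemma shadow_pair:
  assumes b: "flow_box K p c S" and \<delta>: "0 < \<delta>" "112 * K ^ 3 * \<delta> \<le> 1"
    and q: "rdist A g p q \<le> ennreal (\<delta> * speed p)" and r: "rdist A g p r \<le> ennreal (\<delta> * speed p)"
    and ab: "\<bar>a\<bar> \<le> 28 * K\<^sup>2 * \<delta>" "\<bar>b'\<bar> \<le> 28 * K\<^sup>2 * \<delta>"
  shows "rdist A g (\<phi> a q) (\<phi> b' r) \<le> ennreal (512 * K ^ 4 * \<delta> * speed (\<phi> a q))"
proof -
  define F where "F = norm (X p c)"
  let ?\<kappa> = "chart_map c"
  have 0: "\<bar>0\<bar> \<le> 1 / (4 * K)" using K by simp
  have \<tau>: "\<bar>a\<bar> \<le> 1 / (4 * K)" "\<bar>b'\<bar> \<le> 1 / (4 * K)" using ab small_delta(3)[OF \<delta>] by linarith+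
  note nq = shadow_chart[OF b \<delta> q, folded F_def] and nr = shadow_chart[OF b \<delta> r, folded F_def]
  have move: "dist (?\<kappa> (\<phi> t z)) (?\<kappa> z) \<le> 63 * (K\<^sup>2 * \<delta> * F)"
    if z: "rdist A g p z \<le> ennreal (1 / K)" "norm (X z c) \<le> 3 / 2 * F"
      and t: "\<bar>t\<bar> \<le> 28 * K\<^sup>2 * \<delta>" "\<bar>t\<bar> \<le> 1 / (4 * K)" for t z
  proof -
    have "norm (?\<kappa> (\<phi> t z) - ?\<kappa> z - t *\<^sub>R X z c) \<le> \<bar>t\<bar> * norm (X z c) / 2"
      using box_affine(2)[OF b z(1) t(2) 0] by (simp add: flow_zero)
    then have "dist (?\<kappa> (\<phi> t z)) (?\<kappa> z) \<le> 3 / 2 * (\<bar>t\<bar> * norm (X z c))"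
      using norm_triangle_ineq2[of "?\<kappa> (\<phi> t z) - ?\<kappa> z" "t *\<^sub>R X z c"] by (simp add: dist_norm)
    also have "\<dots> \<le> 3 / 2 * ((28 * K\<^sup>2 * \<delta>) * (3 / 2 * F))"
      using t z(2) K \<delta>(1) by (intro mult_left_mono mult_mono) auto
    also have "\<dots> = 63 * (K\<^sup>2 * \<delta> * F)" by simp
    finally show ?thesis .
  qed
  have "dist (?\<kappa> (\<phi> a q)) (?\<kappa> (\<phi> b' r)) \<le> 128 * (K\<^sup>2 * \<delta> * F)"
  proof -
    have "dist (?\<kappa> q) (?\<kappa> r) \<le> 2 * (K\<^sup>2 * \<delta> * F)"
      using dist_triangle3[of "?\<kappa> q" "?\<kappa> r" "?\<kappa> p"] nq(3) nr(3) by linarith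
    then show ?thesis
      using move[OF nq(1,5) ab(1) \<tau>(1)] move[OF nr(1,5) ab(2) \<tau>(2)]
        dist_triangle[of "?\<kappa> (\<phi> a q)" "?\<kappa> (\<phi> b' r)" "?\<kappa> q"]
        dist_triangle[of "?\<kappa> q" "?\<kappa> (\<phi> b' r)" "?\<kappa> r"]
      by (simp add: dist_commute)
  qed
  \<comment> \<open>The tolerance has to be measured by the speed at the new centre
    \<open>\<phi> a q\<close> instead of \<open>p\<close>; each of the passages from
    \<open>p\<close> to \<open>q\<close> and from \<open>q\<close> to \<open>\<phi> a q\<close>
    loses a factor 2.\<close>
  moreover have "F \<le> 4 * K * speed (\<phi> a q)"
  proof -
    have "norm (X (\<phi> a q) c) \<le> K * speed (\<phi> a q)"
      by (rule box_speed(1)[OF b box_stays[OF b \<tau>(1) nq(1)]])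
    moreover have "norm (X q c) / 2 \<le> norm (X (\<phi> a q) c)"
      using box_affine(1)[OF b nq(1) \<tau>(1)] norm_triangle_ineq2[of "X q c" "X (\<phi> a q) c"]
      by (simp add: norm_minus_commute)
    ultimately show ?thesis using nq(4) by simp
  qed
  then have "K\<^sup>2 * \<delta> * F \<le> K\<^sup>2 * \<delta> * (4 * K * speed (\<phi> a q))"
    using \<delta>(1) by (intro mult_left_mono) auto
  ultimately have "dist (?\<kappa> (\<phi> a q)) (?\<kappa> (\<phi> b' r)) \<le> 512 * K ^ 3 * \<delta> * speed (\<phi> a q)"
    by (simp add: power2_eq_square power3_eq_cube mult_ac)
  then have "K * dist (?\<kappa> (\<phi> a q)) (?\<kappa> (\<phi> b' r)) \<le> K * (512 * K ^ 3 * \<delta> * speed (\<phi> a q))"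
    using K by (intro mult_left_mono) auto
  also have "\<dots> = 512 * K ^ 4 * \<delta> * speed (\<phi> a q)" by (simp add: power_numeral_reduce)
  finally have "ennreal (K * dist (?\<kappa> (\<phi> a q)) (?\<kappa> (\<phi> b' r))) \<le> ennreal (512 * K ^ 4 * \<delta> * speed (\<phi> a q))"
    by (rule ennreal_leI)
  then show ?thesis
    using box_rdist_le[OF b box_stays[OF b \<tau>(1) nq(1)] box_stays[OF b \<tau>(2) nr(1)]] by (rule order_trans[rotated])
qed

lemma id_Rep_alpha: "0 \<le> \<alpha> \<Longrightarrow> (\<lambda>s. s) \<in> Rep_alpha \<alpha>"
  by (rule Rep_alphaI) auto

lemma Gamma_subset_Gamma_alpha:
  assumes \<epsilon>: "0 < \<epsilon>"
  obtains \<delta> where "0 < \<delta>"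
    "\<And>x y. y \<in> Gamma A g X \<phi> \<delta> x \<Longrightarrow> Gamma A g X \<phi> \<delta> x \<subseteq> Gamma_alpha A g X \<phi> (1/2) \<epsilon> y"
proof
  \<comment> \<open>The first entry allows smoothing, the second turns the factor of
    \<open>shadow_pair\<close> into \<open>\<epsilon>\<close>.\<close>
  define \<delta> where "\<delta> = min (1 / (560 * K ^ 3)) (\<epsilon> / (512 * K ^ 4))"
  have K0: "0 < K" using K by simp
  show \<delta>: "0 < \<delta>" using K0 \<epsilon> by (simp add: \<delta>_def)
  have "\<delta> \<le> 1 / (560 * K ^ 3)" "\<delta> \<le> \<epsilon> / (512 * K ^ 4)" by (simp_all add: \<delta>_def)
  then have \<delta>1: "560 * K ^ 3 * \<delta> \<le> 1" and \<delta>2: "512 * K ^ 4 * \<delta> \<le> \<epsilon>" 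
    using K0 by (simp_all add: field_simps)
  have "0 < K ^ 3 * \<delta>" using K0 \<delta> by simp
  then have \<delta>3: "112 * K ^ 3 * \<delta> \<le> 1" using \<delta>1 by linarith
  have shadowsE: "\<exists>h\<in>C00. shadows \<delta> h x y" if "y \<in> Gamma A g X \<phi> \<delta> x" for x y
    using that by (auto simp: Gamma_def Gamma_with_def shadows_def)
  fix x y assume y: "y \<in> Gamma A g X \<phi> \<delta> x"
  obtain h where h: "h \<in> C00" "shadows \<delta> h x y" using shadowsE[OF y] by blast
  show "Gamma A g X \<phi> \<delta> x \<subseteq> Gamma_alpha A g X \<phi> (1/2) \<epsilon> y"
  proof
    fix z assume z: "z \<in> Gamma A g X \<phi> \<delta> x"
    obtain k where k: "k \<in> C00" "shadows \<delta> k x z" using shadowsE[OF z] by blast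
    show "z \<in> Gamma_alpha A g X \<phi> (1/2) \<epsilon> y"
    \<comment> \<open>At a zero of the field the tolerance vanishes at time 0, so both
      \<open>y\<close> and \<open>z\<close> equal \<open>x\<close>, and the identity
      reparametrization works because the distance of a point to itself is 0.\<close>
    proof (cases "speed x = 0")
      case True
      have "w = x" if "l \<in> C00" "shadows \<delta> l x w" for l w
        using that(2)[unfolded shadows_def, rule_format, of 0] that(1)
        by (intro rdist_zero_imp_eq[symmetric]) (simp add: C00_def flow_zero True)
      then have "y = x" "z = x" using h k by auto
      then show ?thesis
        unfolding Gamma_alpha_def Gamma_with_def
        by (auto intro!: bexI[OF _ id_Rep_alpha] simp: rdist_refl)
    next
      case False
      obtain h' where h': "h' \<in> Rep_alpha (1/5)" "\<And>s. \<bar>h' s - h s\<bar> \<le> 28 * K\<^sup>2 * \<delta>"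
        using shadow_smoothing[OF h False \<delta> \<delta>1] by blast
      obtain k' where k': "k' \<in> Rep_alpha (1/5)" "\<And>s. \<bar>k' s - k s\<bar> \<le> 28 * K\<^sup>2 * \<delta>"
        using shadow_smoothing[OF k False \<delta> \<delta>1] by blast
      obtain m where m: "m \<in> Rep_alpha (1/2)" "\<And>s. m (h' s) = k' s"
        using Rep_alpha_quotient[OF h'(1) k'(1)] by blast
      have "rdist A g (\<phi> \<sigma> y) (\<phi> (m \<sigma>) z) \<le> ennreal (\<epsilon> * speed (\<phi> \<sigma> y))" for \<sigma>
      proof -
        \<comment> \<open>Surjectivity of \<open>h'\<close> lets every time \<open>\<sigma>\<close>
          on the orbit of \<open>y\<close> be compared with \<open>z\<close> through the common
          point \<open>\<phi> s x\<close>.\<close>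
        obtain s where s: "\<sigma> = h' s" using Rep_alpha_surj[OF h'(1)] by (auto elim: surjE)
        obtain c S where b: "flow_box K (\<phi> s x) c S" using box by blast
        have "rdist A g (\<phi> (h' s - h s) (\<phi> (h s) y)) (\<phi> (k' s - k s) (\<phi> (k s) z)) \<le>
            ennreal (512 * K ^ 4 * \<delta> * speed (\<phi> (h' s - h s) (\<phi> (h s) y)))"
          using h(2) k(2) unfolding shadows_def
          by (intro shadow_pair[OF b \<delta> \<delta>3 _ _ h'(2) k'(2)]) auto
        then have "rdist A g (\<phi> \<sigma> y) (\<phi> (m \<sigma>) z) \<le> ennreal (512 * K ^ 4 * \<delta> * speed (\<phi> \<sigma> y))"
          by (simp add: s m(2) flip: flow_add)
        also have "\<dots> \<le> ennreal (\<epsilon> * speed (\<phi> \<sigma> y))"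
          by (intro ennreal_leI mult_right_mono \<delta>2 speed_nonneg)
        finally show ?thesis .
      qed
      then show ?thesis using m(1) unfolding Gamma_alpha_def Gamma_with_def by blast
    qed
  qed
qed

end

section \<open>Comparison of the three conditions\<close>

lemma Gamma_alpha_subset_Gamma: "Gamma_alpha A g X \<phi> \<alpha> \<epsilon> x \<subseteq> Gamma A g X \<phi> \<epsilon> x"
  by (auto simp: Gamma_alpha_def Gamma_def Gamma_with_def Rep_alpha_def)

lemma Gamma_alpha_star_eq:
  assumes "\<alpha> < 1"
  shows "Gamma_alpha_star A g X \<phi> \<alpha> \<epsilon> x = Gamma_alpha A g X \<phi> \<alpha> \<epsilon> x"
  using Rep_alpha_subset_Rep[OF assms] by (simp add: Gamma_alpha_star_def Gamma_alpha_def Int_absorb2)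

lemma measure_zero_subset: "measure_zero \<mu> S \<Longrightarrow> R \<subseteq> S \<Longrightarrow> measure_zero \<mu> R"
  unfolding measure_zero_def by (rule null_sets_completion_subset[rotated])

theorem theorem1p3:
  fixes A :: "('m::t2_space, 'e::euclidean_space) chart set"
    and g :: "'m \<Rightarrow> ('m, 'e) tvec \<Rightarrow> ('m, 'e) tvec \<Rightarrow> real"
    and X :: "'m \<Rightarrow> ('m, 'e) tvec"
    and \<phi> :: "real \<Rightarrow> 'm \<Rightarrow> 'm"
    and \<mu> :: "'m measure"
  assumes "compact (UNIV :: 'm set)"
    and "smooth_atlas A"
    and "riemannian_metric A g"
    and "C1_vector_field A X"
    and "flow_generated_by A X \<phi>"
    and "prob_space \<mu>"
    and "sets \<mu> = sets borel"
  shows "(rescaled_expansive A g X \<phi> \<mu> \<longleftrightarrow>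
            (\<forall>\<alpha>\<in>{0<..<1}. \<exists>\<epsilon>>0. AE x in \<mu>. measure_zero \<mu> (Gamma_alpha A g X \<phi> \<alpha> \<epsilon> x))) \<and>
         ((\<forall>\<alpha>\<in>{0<..<1}. \<exists>\<epsilon>>0. AE x in \<mu>. measure_zero \<mu> (Gamma_alpha A g X \<phi> \<alpha> \<epsilon> x)) \<longleftrightarrow>
            (\<forall>\<alpha>\<in>{0<..<1}. \<exists>\<epsilon>>0. AE x in \<mu>. measure_zero \<mu> (Gamma_alpha_star A g X \<phi> \<alpha> \<epsilon> x)))"
    (is "(?one \<longleftrightarrow> ?two) \<and> (?two \<longleftrightarrow> ?three)")
proof
  interpret riemannian_flow A g X \<phi> by unfold_locales (rule assms)+
  obtain K where K: "1 \<le> K" "\<And>p. \<exists>c S. flow_box K p c S"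
    using uniform_flow_box[OF assms(1)] by blast
  interpret boxed_flow A g X \<phi> K by unfold_locales (rule K)+
  show "?one \<longleftrightarrow> ?two"
  proof
    assume ?one
    then obtain \<epsilon> where "0 < \<epsilon>" "\<And>x. measure_zero \<mu> (Gamma A g X \<phi> \<epsilon> x)"
      by (auto simp: rescaled_expansive_def)
    then show ?two by (blast intro: measure_zero_subset[OF _ Gamma_alpha_subset_Gamma] AE_I2)
  next
    assume ?two
    \<comment> \<open>The value \<open>1/2\<close> is the slope tolerance delivered by
      \<open>Gamma_subset_Gamma_alpha\<close>.\<close>
    then obtain \<epsilon> where \<epsilon>: "0 < \<epsilon>" "AE x in \<mu>. measure_zero \<mu> (Gamma_alpha A g X \<phi> (1/2) \<epsilon> x)"
      by (elim ballE[of _ _ "1/2"]) auto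
    obtain N where N: "N \<in> null_sets \<mu>"
      "{x \<in> space \<mu>. \<not> measure_zero \<mu> (Gamma_alpha A g X \<phi> (1/2) \<epsilon> x)} \<subseteq> N"
      using \<epsilon>(2) unfolding eventually_ae_filter by blast
    have space: "space \<mu> = UNIV" using sets_eq_imp_space_eq[OF assms(7)] by simp
    obtain \<delta> where \<delta>: "0 < \<delta>"
      "\<And>x y. y \<in> Gamma A g X \<phi> \<delta> x \<Longrightarrow> Gamma A g X \<phi> \<delta> x \<subseteq> Gamma_alpha A g X \<phi> (1/2) \<epsilon> y"
      using Gamma_subset_Gamma_alpha[OF \<epsilon>(1)] by blast
    have "measure_zero \<mu> (Gamma A g X \<phi> \<delta> x)" for x
    \<comment> \<open>Either the set sits inside the exceptional null set \<open>N\<close>, or it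
      has a point \<open>y\<close> outside \<open>N\<close>, and then it is covered by the null set
      centred at \<open>y\<close>. This passes from almost every centre to every centre.\<close>
    proof (cases "Gamma A g X \<phi> \<delta> x \<subseteq> N")
      case True
      have "measure_zero \<mu> N"
        unfolding measure_zero_def by (rule null_sets_completionI[OF N(1)])
      then show ?thesis using True by (rule measure_zero_subset)
    next
      case False
      then obtain y where y: "y \<in> Gamma A g X \<phi> \<delta> x" "y \<notin> N" by blast
      then have "measure_zero \<mu> (Gamma_alpha A g X \<phi> (1/2) \<epsilon> y)" using N(2) space by auto
      then show ?thesis using \<delta>(2)[OF y(1)] by (rule measure_zero_subset)
    qed
    then show ?one using \<delta>(1) by (auto simp: rescaled_expansive_def)
  qed
  show "?two \<longleftrightarrow> ?three" by (simp add: Gamma_alpha_star_eq)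
qed

end
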